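(* Let $\mathbb V,\mathbb W\subset \operatorname{Rad}(kE)$ be two linear subspaces each of which is a splitting of the projection $\operatorname{Rad}(kE)\to\operatorname{Rad}(kE)/\operatorname{Rad}^2(kE)$, and let $\psi:\mathbb V\to\mathbb W$ be the unique isomorphism commuting with the projection isomorphisms to $\operatorname{Rad}(kE)/\operatorname{Rad}^2(kE)$. Let $1\le r\le n$, and denote by $\Psi:\operatorname{Grass}(r,\mathbb V)\to\operatorname{Grass}(r,\mathbb W)$, $U\mapsto\psi(U)$, the induced isomorphism of Grassmannians. Let $M$ be a finite dimensional $kE$-module. Then: \begin{enumerate} \item $\Psi$ restricts to an isomorphism $\operatorname{Rad}(r,\mathbb V)_M\to\operatorname{Rad}(r,\mathbb W)_M$. \item For any $U\in\operatorname{Grass}(r,\mathbb V)$ with $U\notin\operatorname{Rad}(r,\mathbb V)_M$, $\dim\operatorname{Rad}_U(M)=\dim\operatorname{Rad}_{\Psi(U)}(M)$. \item $\max_{V\in\operatorname{Grass}(r,\mathbb V)}\dim\operatorname{Rad}_V(M)=\max_{W\in\operatorname{Grass}(r,\mathbb W)}\dim\operatorname{Rad}_W(M)$. \end{enumerate}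
   Context: $k$ is an algebraically closed field of characteristic $p>0$, $E$ is an elementary abelian $p$-group of rank $n\ge1$, and $kE\cong k[x_1,\dots,x_n]/(x_1^p,\dots,x_n^p)$ is its group algebra with Jacobson radical $\operatorname{Rad}(kE)$. A subspace $\mathbb V\subset\operatorname{Rad}(kE)$ is a splitting of the projection $\operatorname{Rad}(kE)\to\operatorname{Rad}(kE)/\operatorname{Rad}^2(kE)$ if the composition $\mathbb V\hookrightarrow\operatorname{Rad}(kE)\to\operatorname{Rad}(kE)/\operatorname{Rad}^2(kE)$ is an isomorphism of vector spaces. $\operatorname{Grass}(r,\mathbb V)$ is the Grassmann variety of $r$-dimensional linear subspaces ($r$-planes) of $\mathbb V$. For an $r$-plane $U\subset\mathbb V$ and a $kE$-module $M$, $\operatorname{Rad}_U(M)=\sum_{u\in U}uM$. The nonmaximal $r$-radical support variety of $M$ is $$\operatorname{Rad}(r,\mathbb V)_M=\{U\in\operatorname{Grass}(r,\mathbb V)\ :\ \dim\operatorname{Rad}_U(M)<\max_{U'\in\operatorname{Grass}(r,\mathbb V)}\dim\operatorname{Rad}_{U'}(M)\},$$ a closed subvariety of $\operatorname{Grass}(r,\mathbb V)$; $\operatorname{Rad}(r,\mathbb W)_M$ is defined in the same way with $\mathbb W$ in place of $\mathbb V$. *)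

theory Defs
  imports
    "HOL-Analysis.Analysis"
    "HOL-Library.Poly_Mapping"
    "HOL-Computational_Algebra.Computational_Algebra"
    "Jordan_Normal_Form.Determinant"
begin

section \<open>Commutative rings\<close>

definition ring_ideal :: "'a::comm_ring_1 set \<Rightarrow> bool" where
  "ring_ideal I \<longleftrightarrow> module.subspace (*) I"

definition maximal_ideal :: "'a::comm_ring_1 set \<Rightarrow> bool" where
  "maximal_ideal I \<longleftrightarrow> ring_ideal I \<and> I \<noteq> UNIV \<and>
     (\<forall>J. ring_ideal J \<longrightarrow> I \<subseteq> J \<longrightarrow> J = I \<or> J = UNIV)"

definition jacobson_radical :: "'a::comm_ring_1 set" where
  "jacobson_radical = \<Inter> {I. maximal_ideal I}"

definition jacobson_radical_sq :: "'a::comm_ring_1 set" where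
  "jacobson_radical_sq = module.span (*) {a * b | a b. a \<in> jacobson_radical \<and> b \<in> jacobson_radical}"

text \<open>The projection \<open>Rad \<rightarrow> Rad/Rad\<^sup>2\<close>, sending an element to its coset.\<close>

definition rad_proj :: "'a::comm_ring_1 \<Rightarrow> 'a set" where
  "rad_proj x = {x + y | y. y \<in> jacobson_radical_sq}"


section \<open>Group algebras of elementary abelian groups\<close>

text \<open>
  For an additively written abelian group \<open>'e\<close>, the type \<open>'e \<Rightarrow>\<^sub>0 'k\<close> carries the convolution
  product, so it is the group algebra of \<open>'e\<close> over \<open>'k\<close>.
\<close>

definition elementary_abelian :: "nat \<Rightarrow> nat \<Rightarrow> 'e::{ab_group_add, finite} itself \<Rightarrow> bool" where
  "elementary_abelian p n _ \<longleftrightarrow>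
     prime p \<and> card (UNIV :: 'e set) = p ^ n \<and> (\<forall>g::'e. (\<Sum>i<p. g) = 0)"

definition alg_scale ::
    "'k::field \<Rightarrow> ('e::ab_group_add \<Rightarrow>\<^sub>0 'k) \<Rightarrow> ('e \<Rightarrow>\<^sub>0 'k)" where
  "alg_scale c x = Poly_Mapping.single 0 c * x"

text \<open>Restriction of scalars of a \<open>kE\<close>-module along \<open>k \<rightarrow> kE\<close>.\<close>

definition mod_scale ::
    "(('e::ab_group_add \<Rightarrow>\<^sub>0 'k::field) \<Rightarrow> 'm \<Rightarrow> 'm::ab_group_add) \<Rightarrow> 'k \<Rightarrow> 'm \<Rightarrow> 'm" where
  "mod_scale act c m = act (Poly_Mapping.single 0 c) m"

lemma vector_space_mod_scale:
  assumes "Modules.module act"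
  shows "vector_space (mod_scale act)"
proof -
  interpret M: Modules.module act by fact
  show ?thesis
    by unfold_locales
      (simp_all add: mod_scale_def M.scale_right_distrib M.scale_left_distrib
        single_add mult_single)
qed

lemma alg_scale_eq: "alg_scale = mod_scale (*)"
  by (simp add: fun_eq_iff alg_scale_def mod_scale_def)

global_interpretation kE: vector_space
  "alg_scale :: 'k::field \<Rightarrow> ('e::ab_group_add \<Rightarrow>\<^sub>0 'k) \<Rightarrow> ('e \<Rightarrow>\<^sub>0 'k)"
  unfolding alg_scale_eq
  by (rule vector_space_mod_scale) (unfold_locales, auto simp: algebra_simps)

definition fin_dim_module ::
    "(('e::ab_group_add \<Rightarrow>\<^sub>0 'k::field) \<Rightarrow> 'm \<Rightarrow> 'm::ab_group_add) \<Rightarrow> bool" where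
  "fin_dim_module act \<longleftrightarrow> Modules.module act \<and>
     (\<exists>B. finite B \<and> module.span (mod_scale act) B = UNIV)"

text \<open>
  The composite of \<open>V \<subseteq> Rad(kE)\<close> with the projection is automatically linear, so it is an
  isomorphism as soon as it is a bijection onto the set of all cosets.
\<close>

definition splitting :: "('e::ab_group_add \<Rightarrow>\<^sub>0 'k::field) set \<Rightarrow> bool" where
  "splitting V \<longleftrightarrow> kE.subspace V \<and> V \<subseteq> jacobson_radical \<and>
     bij_betw rad_proj V (rad_proj ` jacobson_radical)"

definition linear_between ::
    "('k \<Rightarrow> 'v \<Rightarrow> 'v) \<Rightarrow> ('k \<Rightarrow> 'w \<Rightarrow> 'w) \<Rightarrow> 'v::ab_group_add set \<Rightarrow> 'w::ab_group_add set \<Rightarrow>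
     ('v \<Rightarrow> 'w) \<Rightarrow> bool" where
  "linear_between s t V W f \<longleftrightarrow> f \<in> V \<rightarrow> W \<and>
     (\<forall>x\<in>V. \<forall>y\<in>V. f (x + y) = f x + f y) \<and> (\<forall>c. \<forall>x\<in>V. f (s c x) = t c (f x))"

text \<open>Only the values of \<open>\<psi>\<close> on \<open>V\<close> matter.\<close>

definition splitting_iso ::
    "('e::ab_group_add \<Rightarrow>\<^sub>0 'k::field) set \<Rightarrow> ('e \<Rightarrow>\<^sub>0 'k) set \<Rightarrow>
     (('e \<Rightarrow>\<^sub>0 'k) \<Rightarrow> ('e \<Rightarrow>\<^sub>0 'k)) \<Rightarrow> bool" where
  "splitting_iso V W \<psi> \<longleftrightarrow>
     linear_between alg_scale alg_scale V W \<psi> \<and> bij_betw \<psi> V W \<and>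
     (\<forall>v\<in>V. rad_proj (\<psi> v) = rad_proj v)"

lemma rad_proj_eq_iff: "rad_proj x = rad_proj y \<longleftrightarrow> x - y \<in> jacobson_radical_sq"
proof -
  interpret R: Modules.module "(*) :: 'a::comm_ring_1 \<Rightarrow> 'a \<Rightarrow> 'a"
    by unfold_locales (auto simp: algebra_simps)
  have sub: "R.subspace (jacobson_radical_sq :: 'a set)"
    unfolding jacobson_radical_sq_def by (rule R.subspace_span)
  have mem: "z \<in> rad_proj x \<longleftrightarrow> z - x \<in> jacobson_radical_sq" for z x :: 'a
    unfolding rad_proj_def by (auto intro!: exI[of _ "z - x"])
  show ?thesis
  proof
    assume "rad_proj x = rad_proj y"
    then show "x - y \<in> jacobson_radical_sq"
      using mem[of x x] mem[of x y] R.subspace_0[OF sub] by simp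
  next
    assume *: "x - y \<in> jacobson_radical_sq"
    have "z - x \<in> jacobson_radical_sq \<longleftrightarrow> z - y \<in> jacobson_radical_sq" for z
      using R.subspace_add[OF sub _ *, of "z - x"] R.subspace_diff[OF sub _ *, of "z - y"] by auto
    then show "rad_proj x = rad_proj y"
      using mem by blast
  qed
qed

lemma splitting_iso_exists_unique:
  assumes V: "splitting V" and W: "splitting W"
  shows "\<exists>\<psi>. splitting_iso V W \<psi>"
    and "splitting_iso V W \<psi> \<Longrightarrow> splitting_iso V W \<psi>' \<Longrightarrow> v \<in> V \<Longrightarrow> \<psi> v = \<psi>' v"
proof -
  note sV = V[unfolded splitting_def] and sW = W[unfolded splitting_def]
  interpret R: Modules.module "(*) :: ('a \<Rightarrow>\<^sub>0 'b) \<Rightarrow> ('a \<Rightarrow>\<^sub>0 'b) \<Rightarrow> ('a \<Rightarrow>\<^sub>0 'b)"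
    by unfold_locales (auto simp: algebra_simps)
  have sub: "R.subspace jacobson_radical_sq"
    unfolding jacobson_radical_sq_def by (rule R.subspace_span)
  have inj: "x = y" if "x \<in> W" "y \<in> W" "x - y \<in> jacobson_radical_sq" for x y
    using that sW rad_proj_eq_iff[of x y] by (auto simp: bij_betw_def inj_on_def)
  define \<psi> where "\<psi> v = inv_into W rad_proj (rad_proj v)" for v
  have bij: "bij_betw \<psi> V W"
    using bij_betw_trans[OF conjunct2[OF conjunct2[OF sV]]
        bij_betw_inv_into[OF conjunct2[OF conjunct2[OF sW]]]]
    by (simp add: \<psi>_def[abs_def] comp_def)
  have proj: "rad_proj (\<psi> v) = rad_proj v" if "v \<in> V" for v
    using that sV sW unfolding \<psi>_def by (intro f_inv_into_f) (auto simp: bij_betw_def)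
  have mem: "\<psi> v \<in> W" if "v \<in> V" for v
    using that bij by (auto simp: bij_betw_def)
  have d: "\<psi> v - v \<in> jacobson_radical_sq" if "v \<in> V" for v
    using proj[OF that] rad_proj_eq_iff by blast
  have "\<psi> (x + y) = \<psi> x + \<psi> y" if "x \<in> V" "y \<in> V" for x y
  proof (rule inj)
    have xy: "x + y \<in> V" using that sV kE.subspace_add by blast
    show "\<psi> (x + y) \<in> W" by (rule mem[OF xy])
    show "\<psi> x + \<psi> y \<in> W" using that mem sW kE.subspace_add by blast
    show "\<psi> (x + y) - (\<psi> x + \<psi> y) \<in> jacobson_radical_sq"
      using R.subspace_diff[OF sub d[OF xy] R.subspace_add[OF sub d[OF that(1)] d[OF that(2)]]]
      by (simp add: algebra_simps)
  qed
  moreover have "\<psi> (alg_scale c x) = alg_scale c (\<psi> x)" if "x \<in> V" for c x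
  proof (rule inj)
    have cx: "alg_scale c x \<in> V" using that sV kE.subspace_scale by blast
    show "\<psi> (alg_scale c x) \<in> W" by (rule mem[OF cx])
    show "alg_scale c (\<psi> x) \<in> W" using that mem sW kE.subspace_scale by blast
    show "\<psi> (alg_scale c x) - alg_scale c (\<psi> x) \<in> jacobson_radical_sq"
      using R.subspace_diff[OF sub d[OF cx]
          R.subspace_scale[OF sub d[OF that], of "Poly_Mapping.single 0 c"]]
      by (simp add: algebra_simps alg_scale_def)
  qed
  ultimately have "splitting_iso V W \<psi>"
    using bij proj mem unfolding splitting_iso_def linear_between_def by blast
  then show "\<exists>\<psi>. splitting_iso V W \<psi>" by blast
  show "\<psi> v = \<psi>' v" if "splitting_iso V W \<psi>" "splitting_iso V W \<psi>'" "v \<in> V" for \<psi> \<psi>' v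
    using that rad_proj_eq_iff[of "\<psi> v" "\<psi>' v"]
    by (intro inj) (auto simp: splitting_iso_def bij_betw_def)
qed


section \<open>Grassmannians as varieties\<close>

definition Grass :: "('k::field \<Rightarrow> 'v \<Rightarrow> 'v) \<Rightarrow> nat \<Rightarrow> 'v::ab_group_add set \<Rightarrow> 'v set set" where
  "Grass s r V = {U. module.subspace s U \<and> U \<subseteq> V \<and> vector_space.dim s U = r}"

definition ordered_basis ::
    "('k::field \<Rightarrow> 'v \<Rightarrow> 'v) \<Rightarrow> nat \<Rightarrow> 'v::ab_group_add set \<Rightarrow> (nat \<Rightarrow> 'v) \<Rightarrow> bool" where
  "ordered_basis s r U u \<longleftrightarrow> inj_on u {..<r} \<and>
     \<not> module.dependent s (u ` {..<r}) \<and> module.span s (u ` {..<r}) = U"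

text \<open>
  The Pluecker coordinate attached to linear forms \<open>l\<^sub>0, \<dots>, l\<^bsub>r-1\<^esub>\<close> on \<open>V\<close>, evaluated on an
  ordered basis \<open>u\<close> of an \<open>r\<close>-plane.  Choosing the \<open>l\<^sub>i\<close> among the coordinate forms of a basis
  of \<open>V\<close> gives the usual Pluecker coordinates; the others are linear combinations of these.
  Changing \<open>u\<close> multiplies all Pluecker coordinates of the plane by a common nonzero scalar.
\<close>

definition pluecker :: "nat \<Rightarrow> (nat \<Rightarrow> 'v \<Rightarrow> 'k::field) \<Rightarrow> (nat \<Rightarrow> 'v) \<Rightarrow> 'k" where
  "pluecker r l u = Determinant.det (Matrix.mat r r (\<lambda>(i, j). l i (u j)))"

text \<open>
  \<open>pluecker_form s r V d F\<close>: \<open>F\<close> is a homogeneous polynomial of degree \<open>d\<close> in the Pluecker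
  coordinates on \<open>Grass s r V\<close>, viewed as a function of an ordered basis.
\<close>

inductive pluecker_form ::
    "('k::field \<Rightarrow> 'v \<Rightarrow> 'v) \<Rightarrow> nat \<Rightarrow> 'v::ab_group_add set \<Rightarrow> nat \<Rightarrow> ((nat \<Rightarrow> 'v) \<Rightarrow> 'k) \<Rightarrow> bool"
  for s :: "'k::field \<Rightarrow> 'v::ab_group_add \<Rightarrow> 'v" and r :: nat and V :: "'v set"
where
  const: "pluecker_form s r V 0 (\<lambda>u. c)"
| add: "pluecker_form s r V d F \<Longrightarrow> pluecker_form s r V d G \<Longrightarrow>
    pluecker_form s r V d (\<lambda>u. F u + G u)"
| mult: "pluecker_form s r V d F \<Longrightarrow> (\<And>i. i < r \<Longrightarrow> linear_between s (*) V UNIV (l i)) \<Longrightarrow>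
    pluecker_form s r V (Suc d) (\<lambda>u. pluecker r l u * F u)"

text \<open>
  The Zariski topology: the nonvanishing loci of homogeneous forms are a basis of it, and its
  closed sets are the common zero loci of sets of homogeneous forms.
\<close>

definition nonvanishing ::
    "('k::field \<Rightarrow> 'v \<Rightarrow> 'v) \<Rightarrow> nat \<Rightarrow> 'v::ab_group_add set \<Rightarrow> ((nat \<Rightarrow> 'v) \<Rightarrow> 'k) \<Rightarrow> 'v set set" where
  "nonvanishing s r V F = {U \<in> Grass s r V. \<forall>u. ordered_basis s r U u \<longrightarrow> F u \<noteq> 0}"

definition zariski ::
    "('k::field \<Rightarrow> 'v \<Rightarrow> 'v) \<Rightarrow> nat \<Rightarrow> 'v::ab_group_add set \<Rightarrow> 'v set topology" where
  "zariski s r V = topology_generated_by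
     {nonvanishing s r V F | F d. pluecker_form s r V d F}"

text \<open>
  Subsets \<open>X\<close> of \<open>Grass s r V\<close> get the subspace topology and the reduced induced structure: a
  function on an open subset of \<open>X\<close> is regular if it is locally a quotient of homogeneous forms
  of equal degree.
\<close>

definition regular_on ::
    "('k::field \<Rightarrow> 'v \<Rightarrow> 'v) \<Rightarrow> nat \<Rightarrow> 'v::ab_group_add set \<Rightarrow> 'v set set \<Rightarrow> 'v set set \<Rightarrow>
     ('v set \<Rightarrow> 'k) \<Rightarrow> bool" where
  "regular_on s r V X A f \<longleftrightarrow>
     (\<forall>U\<in>A. \<exists>N d. openin (subtopology (zariski s r V) X) N \<and> U \<in> N \<and> N \<subseteq> A \<and>
       (\<exists>F G. pluecker_form s r V d F \<and> pluecker_form s r V d G \<and>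
          (\<forall>U'\<in>N. \<forall>u. ordered_basis s r U' u \<longrightarrow> G u \<noteq> 0 \<and> f U' = F u / G u)))"

definition variety_morphism ::
    "('k::field \<Rightarrow> 'v \<Rightarrow> 'v) \<Rightarrow> nat \<Rightarrow> 'v::ab_group_add set \<Rightarrow> 'v set set \<Rightarrow>
     ('k \<Rightarrow> 'w \<Rightarrow> 'w) \<Rightarrow> nat \<Rightarrow> 'w::ab_group_add set \<Rightarrow> 'w set set \<Rightarrow> ('v set \<Rightarrow> 'w set) \<Rightarrow> bool" where
  "variety_morphism s r V X t q W Y \<phi> \<longleftrightarrow>
     continuous_map (subtopology (zariski s r V) X) (subtopology (zariski t q W) Y) \<phi> \<and>
     (\<forall>A f. openin (subtopology (zariski t q W) Y) A \<longrightarrow> regular_on t q W Y A f \<longrightarrow>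
        regular_on s r V X (X \<inter> \<phi> -` A) (\<lambda>U. f (\<phi> U)))"

definition variety_iso ::
    "('k::field \<Rightarrow> 'v \<Rightarrow> 'v) \<Rightarrow> nat \<Rightarrow> 'v::ab_group_add set \<Rightarrow> 'v set set \<Rightarrow>
     ('k \<Rightarrow> 'w \<Rightarrow> 'w) \<Rightarrow> nat \<Rightarrow> 'w::ab_group_add set \<Rightarrow> 'w set set \<Rightarrow> ('v set \<Rightarrow> 'w set) \<Rightarrow> bool" where
  "variety_iso s r V X t q W Y \<phi> \<longleftrightarrow>
     variety_morphism s r V X t q W Y \<phi> \<and>
     (\<exists>\<theta>. variety_morphism t q W Y s r V X \<theta> \<and>
        (\<forall>U\<in>X. \<theta> (\<phi> U) = U) \<and> (\<forall>U\<in>Y. \<phi> (\<theta> U) = U))"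


section \<open>Radicals of modules\<close>

definition Rad_plane ::
    "(('e::ab_group_add \<Rightarrow>\<^sub>0 'k::field) \<Rightarrow> 'm \<Rightarrow> 'm::ab_group_add) \<Rightarrow> ('e \<Rightarrow>\<^sub>0 'k) set \<Rightarrow> 'm set" where
  "Rad_plane act U = module.span (mod_scale act) (\<Union>u\<in>U. range (act u))"

definition rad_dim ::
    "(('e::ab_group_add \<Rightarrow>\<^sub>0 'k::field) \<Rightarrow> 'm \<Rightarrow> 'm::ab_group_add) \<Rightarrow> ('e \<Rightarrow>\<^sub>0 'k) set \<Rightarrow> nat" where
  "rad_dim act U = vector_space.dim (mod_scale act) (Rad_plane act U)"

definition max_rad_dim ::
    "nat \<Rightarrow> ('e \<Rightarrow>\<^sub>0 'k) set \<Rightarrow>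
     (('e::ab_group_add \<Rightarrow>\<^sub>0 'k::field) \<Rightarrow> 'm \<Rightarrow> 'm::ab_group_add) \<Rightarrow> nat" where
  "max_rad_dim r V act = Max (rad_dim act ` Grass alg_scale r V)"

definition Rad_variety ::
    "nat \<Rightarrow> ('e \<Rightarrow>\<^sub>0 'k) set \<Rightarrow>
     (('e::ab_group_add \<Rightarrow>\<^sub>0 'k::field) \<Rightarrow> 'm \<Rightarrow> 'm::ab_group_add) \<Rightarrow> ('e \<Rightarrow>\<^sub>0 'k) set set" where
  "Rad_variety r V act = {U \<in> Grass alg_scale r V. rad_dim act U < max_rad_dim r V act}"

end

theory Submission
  imports Defs
begin

text \<open>
  Write a plane as the span of a tuple \<open>u\<^sub>1, \<dots>, u\<^sub>r\<close>; then \<open>\<psi>(u\<^sub>i) - u\<^sub>i \<in> Rad\<^sup>2 = Rad \<cdot> V\<close>, the last equality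
  by Nakayama, so \<open>\<psi>(u)\<close> arises from \<open>u\<close> by finitely many steps \<open>u\<^sub>i \<mapsto> u\<^sub>i + g w\<close> with \<open>g \<in> Rad\<close> and
  \<open>w \<in> V\<close>.  If \<open>dim (\<Sum> u\<^sub>i M)\<close> is maximal under translation of the tuple by elements of \<open>V\<close>, it is
  in particular maximal at \<open>t = 0\<close> along the line \<open>u\<^sub>i + t w\<close>, and then it stays the same
  when \<open>t\<close> is replaced by the nilpotent operator \<open>g\<close>; the maximality property is inherited by the
  new tuple.  Hence \<open>\<psi>\<close> preserves the dimension at planes where it is maximal, and the same holds for
  the inverse of \<open>\<psi>\<close>, which gives everything else.
\<close>

section \<open>Linear algebra\<close>

text \<open>Maximality controls motion only in directions taken from V, while an element of Rad^2 is
  a priori a sum of products with both factors in Rad; rewriting it over V is what brings every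
  correction into the form \<open>g * w\<close>. The intermediate tuples have entries outside V and
  are points of no Grassmannian of V, so maximality has to be recorded for tuples, relative to
  translation by V. Over an infinite field finitely many generic conditions hold at one common
  \<open>t\<close>, and additivity of p-th powers turns the nilpotent substitution into a comparison
  of kernels. Dimensions at nonmaximal planes are never compared: only maximality is transported,
  through \<psi> and back.\<close>

context vector_space_pair
begin

lemma dim_inj_image:
  assumes "Vector_Spaces.linear s1 s2 f" and "vs1.subspace S" and "inj_on f S"
  shows "vs2.dim (f ` S) = vs1.dim S"
proof -
  interpret f: Vector_Spaces.linear s1 s2 f by fact
  obtain B where B: "B \<subseteq> S" "vs1.independent B" "S \<subseteq> vs1.span B" "card B = vs1.dim S"
    by (rule vs1.basis_exists)
  have S: "vs1.span B = S"
    using B assms(2) by (simp add: vs1.span_subspace)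
  have "vs2.independent (f ` B)"
    using f.independent_injective_image B(2) assms(3) S by blast
  then have "vs2.dim (f ` B) = card B"
    using vs2.dim_eq_card_independent card_image[of f B] inj_on_subset[OF assms(3) B(1)] by simp
  then show ?thesis
    using f.span_image[of B] S B(4) vs2.dim_span by metis
qed

text \<open>Rank-nullity inside a possibly infinite dimensional space, where \<open>dim\<close>
  falls back to 0. Finiteness is supplied by spanning sets of kernel and image and handed back for
  \<open>Z\<close>, ready for induction.\<close>

lemma dim_image_kernel:
  assumes "Vector_Spaces.linear s1 s2 f" and "vs1.subspace Z"
    and "finite A" and "{x \<in> Z. f x = 0} \<subseteq> vs1.span A"
    and "finite C" and "f ` Z \<subseteq> vs2.span C"
  shows "\<exists>B. finite B \<and> Z \<subseteq> vs1.span B"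
    and "vs1.dim Z = vs2.dim (f ` Z) + vs1.dim {x \<in> Z. f x = 0}"
proof -
  interpret f: Vector_Spaces.linear s1 s2 f by fact
  obtain A' where A': "A' \<subseteq> {x \<in> Z. f x = 0}" "vs1.independent A'"
      "{x \<in> Z. f x = 0} \<subseteq> vs1.span A'" "card A' = vs1.dim {x \<in> Z. f x = 0}"
    by (rule vs1.basis_exists)
  have "A' \<subseteq> vs1.span A" using A'(1) assms(4) by blast
  then have finA': "finite A'"
    using vs1.independent_span_bound[OF assms(3) A'(2)] by simp
  obtain B where B: "A' \<subseteq> B" "B \<subseteq> Z" "vs1.independent B" "Z \<subseteq> vs1.span B"
    using vs1.maximal_independent_subset_extend[of A' Z] A' by blast
  define D where "D = B - A'"
  have spanB: "vs1.span B = Z" using B assms(2) by (simp add: vs1.span_subspace)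
  interpret e: vector_space_pair s1 s1 by unfold_locales
  \<comment> \<open>\<open>g\<close> fixes \<open>D\<close> and kills \<open>A'\<close>; on a kernel
    element in the span of \<open>D\<close> it returns both the element and 0, so \<open>f\<close>
    is injective there.\<close>
  obtain g where g: "Vector_Spaces.linear s1 s1 g" "\<forall>x\<in>B. g x = (if x \<in> D then x else 0)"
    using e.linear_independent_extend[OF B(3), of "\<lambda>x. if x \<in> D then x else 0"] by blast
  have kerD: "x = 0" if x: "x \<in> vs1.span D" and fx: "f x = 0" for x
  proof -
    have "D \<subseteq> B" by (auto simp: D_def)
    then have "x \<in> Z" using x vs1.span_mono spanB by blast
    then have "x \<in> vs1.span A'" using fx A' by blast
    moreover have "module_hom s1 s1 g" using g(1) by (simp add: module_hom_iff_linear)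
    ultimately have "g x = 0"
      using module_hom.eq_0_on_span[of s1 s1 g A' x] g(2) B(1) unfolding D_def by fastforce
    moreover have "g x = x"
    proof (rule e.linear_eq_on[OF g(1) vs1.linear_ident x])
      show "\<And>b. b \<in> D \<Longrightarrow> g b = b" using g(2) by (auto simp: D_def)
    qed
    ultimately show ?thesis by simp
  qed
  have injD: "inj_on f (vs1.span D)"
    using f.inj_on_iff_eq_0[of "vs1.span D"] kerD by auto
  have indD: "vs2.independent (f ` D)"
    by (rule f.independent_injective_image[OF vs1.independent_mono[OF B(3)] injD]) (auto simp: D_def)
  have BD: "f ` B \<subseteq> insert 0 (f ` D)" using A'(1) by (auto simp: D_def)
  have "vs2.span (f ` B) = vs2.span (f ` D)"
  proof
    show "vs2.span (f ` B) \<subseteq> vs2.span (f ` D)"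
      using vs2.span_mono[OF BD] by simp
    show "vs2.span (f ` D) \<subseteq> vs2.span (f ` B)"
      by (rule vs2.span_mono) (auto simp: D_def)
  qed
  then have fZ: "f ` Z = vs2.span (f ` D)"
    using f.span_image[of B] spanB by simp
  have inj': "inj_on f D" using injD inj_on_subset vs1.span_superset by blast
  have "f ` D \<subseteq> vs2.span C" using assms(6) vs2.span_superset[of "f ` D"] unfolding fZ by (rule subset_trans[rotated])
  then have "finite (f ` D)" using vs2.independent_span_bound[OF assms(5) indD] by simp
  then have finD: "finite D" using inj' finite_imageD by blast
  have finB: "finite B" using finD finA' by (simp add: D_def)
  then show "\<exists>B. finite B \<and> Z \<subseteq> vs1.span B" using B by blast
  have "vs1.dim Z = card B" using B vs1.basis_card_eq_dim by metis
  also have "\<dots> = card D + card A'"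
    using card_Diff_subset[OF finA' B(1)] card_mono[OF finB B(1)] by (simp add: D_def)
  also have "card D = vs2.dim (f ` Z)"
    using fZ vs2.dim_span_eq_card_independent[OF indD] card_image[OF inj'] by simp
  finally show "vs1.dim Z = vs2.dim (f ` Z) + vs1.dim {x \<in> Z. f x = 0}" using A'(4) by simp
qed

end

context vector_space
begin

text \<open>Surjectivity makes \<open>T\<close> map the kernel of each power onto the kernel of the
  previous one, with kernel ker T, so every power adds the same dimension. The spanning set is
  carried along because \<open>K\<close> may be infinite dimensional.\<close>

lemma dim_kernel_power:
  assumes T: "Vector_Spaces.linear scale scale T" and K: "subspace K" and onto: "T ` K = K"
    and fin: "finite A" "{x \<in> K. T x = 0} \<subseteq> span A"
  shows "(\<exists>B. finite B \<and> {x \<in> K. (T ^^ j) x = 0} \<subseteq> span B) \<and>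
    dim {x \<in> K. (T ^^ j) x = 0} = j * dim {x \<in> K. T x = 0}"
proof (induction j)
  case 0
  have "{x \<in> K. (T ^^ 0) x = 0} = {0}" using K subspace_0 by auto
  moreover have "dim {0} = 0" using dim_le_card[of "{0}" "{}"] by simp
  ultimately show ?case by (metis finite.emptyI mult_0 order_refl span_empty)
next
  case (Suc j)
  interpret e: vector_space_pair scale scale by unfold_locales
  interpret T: Vector_Spaces.linear scale scale T by fact
  let ?Z = "\<lambda>j. {x \<in> K. (T ^^ j) x = 0}"
  have lin: "Vector_Spaces.linear scale scale (T ^^ j)" for j
    proof (induction j)
    case (Suc j)
    then show ?case using Vector_Spaces.linear_compose[OF Suc T] by (simp add: comp_def)
  qed (simp add: linear_id[unfolded id_def])
  have sub: "subspace (?Z j)" for j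
  proof -
    interpret L: Vector_Spaces.linear scale scale "T ^^ j" by (rule lin)
    have "?Z j = K \<inter> {x. (T ^^ j) x = 0}" by auto
    then show ?thesis using subspace_inter[OF K L.subspace_kernel] by simp
  qed
  have Tj0: "(T ^^ j) 0 = 0" for j by (induction j) auto
  have im: "T ` ?Z (Suc j) = ?Z j"
  proof
    show "T ` ?Z (Suc j) \<subseteq> ?Z j" using onto by (auto simp: funpow_Suc_right simp del: funpow.simps)
    show "?Z j \<subseteq> T ` ?Z (Suc j)"
    proof
      fix y assume y: "y \<in> ?Z j"
      then obtain x where "x \<in> K" "y = T x" using onto by blast
      then show "y \<in> T ` ?Z (Suc j)" using y by (auto simp: funpow_Suc_right simp del: funpow.simps)
    qed
  qed
  have ker: "{x \<in> ?Z (Suc j). T x = 0} = {x \<in> K. T x = 0}"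
    using Tj0 by (auto simp: funpow_Suc_right simp del: funpow.simps)
  obtain B where B: "finite B" "?Z j \<subseteq> span B" using Suc by blast
  note RN = e.dim_image_kernel[OF T sub[of "Suc j"] fin(1) _ B(1), unfolded im ker, OF fin(2) B(2)]
  then show ?case using Suc by simp
qed

end

context finite_dimensional_vector_space
begin

text \<open>Eigenvectors for distinct eigenvalues are independent, so there are at most
  \<open>dimension\<close> eigenvalues.\<close>

lemma finite_eigenvalues:
  assumes g: "Vector_Spaces.linear scale scale g"
  shows "finite {\<mu>. \<exists>x. x \<noteq> 0 \<and> g x = scale \<mu> x}" (is "finite ?E")
proof (rule ccontr)
  assume "infinite ?E"
  then obtain F where F: "F \<subseteq> ?E" "finite F" "card F = Suc dimension"
    using infinite_arbitrarily_large[of ?E "Suc dimension"] by metis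
  interpret g: Vector_Spaces.linear scale scale g by fact
  obtain x where x: "\<And>\<mu>. \<mu> \<in> F \<Longrightarrow> x \<mu> \<noteq> 0 \<and> g (x \<mu>) = scale \<mu> (x \<mu>)"
  proof -
    have "\<forall>\<mu>\<in>F. \<exists>x. x \<noteq> 0 \<and> g x = scale \<mu> x" using F(1) by blast
    from bchoice[OF this] show thesis using that by blast
  qed
  have indep: "\<forall>u. (\<Sum>\<mu>\<in>G. scale (u \<mu>) (x \<mu>)) = 0 \<longrightarrow> (\<forall>\<mu>\<in>G. u \<mu> = 0)" if "G \<subseteq> F" for G
    using finite_subset[OF that F(2)] that
  proof (induction G rule: finite_induct)
    case (insert \<nu> G)
    show ?case
    proof (intro allI impI)
      fix u assume u: "(\<Sum>\<mu>\<in>insert \<nu> G. scale (u \<mu>) (x \<mu>)) = 0"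
      then have 1: "scale (u \<nu>) (x \<nu>) + (\<Sum>\<mu>\<in>G. scale (u \<mu>) (x \<mu>)) = 0"
        using insert by simp
      have "g (scale (u \<nu>) (x \<nu>) + (\<Sum>\<mu>\<in>G. scale (u \<mu>) (x \<mu>))) = 0"
        using 1 by simp
      then have 2: "scale (u \<nu>) (scale \<nu> (x \<nu>)) + (\<Sum>\<mu>\<in>G. scale (u \<mu>) (scale \<mu> (x \<mu>))) = 0"
        using x insert.prems by (simp add: g.add g.scale g.sum subset_iff)
      have 3: "scale \<nu> (scale (u \<nu>) (x \<nu>)) + (\<Sum>\<mu>\<in>G. scale \<nu> (scale (u \<mu>) (x \<mu>))) = 0"
        using arg_cong[OF 1, of "scale \<nu>"] by (simp add: scale_right_distrib scale_sum_right)
      \<comment> \<open>Applying \<open>g\<close> to the relation and subtracting \<nu> times it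
        removes the \<nu> term and multiplies the others by \<mu> - \<nu>.\<close>
      have "scale (u \<mu> * (\<mu> - \<nu>)) (x \<mu>) = scale (u \<mu>) (scale \<mu> (x \<mu>)) - scale \<nu> (scale (u \<mu>) (x \<mu>))" for \<mu>
        by (simp add: scale_left_diff_distrib[symmetric] right_diff_distrib mult.commute[of \<nu>])
      then have "(\<Sum>\<mu>\<in>G. scale (u \<mu> * (\<mu> - \<nu>)) (x \<mu>)) =
          (\<Sum>\<mu>\<in>G. scale (u \<mu>) (scale \<mu> (x \<mu>))) - (\<Sum>\<mu>\<in>G. scale \<nu> (scale (u \<mu>) (x \<mu>)))"
        by (simp only: sum_subtractf)
      also have "\<dots> = (scale (u \<nu>) (scale \<nu> (x \<nu>)) + (\<Sum>\<mu>\<in>G. scale (u \<mu>) (scale \<mu> (x \<mu>)))) -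
          (scale \<nu> (scale (u \<nu>) (x \<nu>)) + (\<Sum>\<mu>\<in>G. scale \<nu> (scale (u \<mu>) (x \<mu>))))"
        by (simp only: scale_left_commute[of "u \<nu>"] add_diff_cancel_left)
      also have "\<dots> = 0" by (simp only: 2 3 diff_self)
      finally have "(\<Sum>\<mu>\<in>G. scale (u \<mu> * (\<mu> - \<nu>)) (x \<mu>)) = 0" .
      then have "\<forall>\<mu>\<in>G. u \<mu> * (\<mu> - \<nu>) = 0"
        using spec[OF insert.IH, of "\<lambda>\<mu>. u \<mu> * (\<mu> - \<nu>)"] insert.prems by auto
      then have z: "\<forall>\<mu>\<in>G. u \<mu> = 0" using insert.hyps by auto
      then have "u \<nu> = 0" using 1 x[of \<nu>] insert.prems by simp
      then show "\<forall>\<mu>\<in>insert \<nu> G. u \<mu> = 0" using z by simp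
    qed
  qed simp
  have inj: "inj_on x F"
  proof (rule inj_onI)
    fix \<mu> \<nu> assume F: "\<mu> \<in> F" "\<nu> \<in> F" and eq: "x \<mu> = x \<nu>"
    have "scale \<mu> (x \<mu>) = scale \<nu> (x \<mu>)"
      using x[OF F(1)] x[OF F(2)] unfolding eq by simp
    then show "\<mu> = \<nu>" using x[OF F(1)] by simp
  qed
  have "independent (x ` F)"
    unfolding independent_explicit
  proof (intro conjI allI impI)
    show "finite (x ` F)" using F by simp
    fix c assume "(\<Sum>v\<in>x ` F. scale (c v) v) = 0"
    then have "(\<Sum>\<mu>\<in>F. scale (c (x \<mu>)) (x \<mu>)) = 0" by (simp add: sum.reindex[OF inj])
    then show "\<forall>v\<in>x ` F. c v = 0" using indep[of F] by auto
  qed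
  then have "card (x ` F) \<le> dimension"
    using independent_bound_general dim_subset_UNIV le_trans by metis
  then show False using F(3) card_image[OF inj] by simp
qed

text \<open>
  Lower semicontinuity of the dimension along a line.  A bad \<open>t\<close> yields an eigenvalue \<open>-1/t\<close> of
  the linear map extending \<open>c \<mapsto> d\<close> on a basis of \<open>S 0\<close>.
\<close>

lemma finite_dim_drop:
  assumes "\<And>t. subspace (S t)"
    and "\<And>c. c \<in> S 0 \<Longrightarrow> \<exists>d. \<forall>t. c + scale t d \<in> S t"
  shows "finite {t. dim (S t) < dim (S 0)}"
proof -
  obtain C where C: "finite C" "C \<subseteq> S 0" "independent C" "span C = S 0" "card C = dim (S 0)"
    using basis_subspace_exists[OF assms(1)] by metis
  obtain h where h: "\<And>c t. c \<in> C \<Longrightarrow> c + scale t (h c) \<in> S t"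
  proof -
    have "\<forall>c\<in>C. \<exists>d. \<forall>t. c + scale t d \<in> S t" using assms(2) C(2) by blast
    from bchoice[OF this] show thesis using that by blast
  qed
  interpret e: vector_space_pair scale scale by unfold_locales
  obtain g where g: "Vector_Spaces.linear scale scale g" "\<forall>c\<in>C. g c = h c"
    using e.linear_independent_extend[OF C(3)] by blast
  interpret g: Vector_Spaces.linear scale scale g by fact
  let ?E = "{\<mu>. \<exists>x. x \<noteq> 0 \<and> g x = scale \<mu> x}"
  have "t \<in> (\<lambda>\<mu>. - inverse \<mu>) ` ?E" if t: "dim (S t) < dim (S 0)" for t
  proof (rule ccontr)
    assume nt: "t \<notin> (\<lambda>\<mu>. - inverse \<mu>) ` ?E"
    have t0: "t \<noteq> 0" using t by auto
    define f where "f x = x + scale t (g x)" for x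
    have lin: "Vector_Spaces.linear scale scale f"
      unfolding Vector_Spaces.linear_iff f_def
      by (auto simp: g.add g.scale scale_right_distrib mult.commute intro: vector_space_axioms)
    interpret f: Vector_Spaces.linear scale scale f by fact
    have "x = 0" if "f x = 0" for x
    proof (rule ccontr)
      assume "x \<noteq> 0"
      have "scale (inverse t) x + g x = scale (inverse t) (f x)"
        using t0 by (simp add: f_def scale_right_distrib)
      then have "g x = scale (- inverse t) x" using that by (simp add: add_eq_0_iff)
      then have "- inverse t \<in> ?E" using \<open>x \<noteq> 0\<close> by blast
      then have "- inverse (- inverse t) \<in> (\<lambda>\<mu>. - inverse \<mu>) ` ?E" by (rule imageI)
      then show False using nt by simp
    qed
    then have inj: "inj f" using f.inj_iff_eq_0 by blast
    have "f ` C \<subseteq> S t" using h g(2) by (auto simp: f_def)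
    moreover have "independent (f ` C)"
      using f.independent_inj_image[OF C(3) inj] .
    ultimately have "card (f ` C) \<le> dim (S t)" by (rule independent_card_le_dim)
    then show False using t C(5) card_image[OF inj_on_subset[OF inj subset_UNIV]] by simp
  qed
  then have "{t. dim (S t) < dim (S 0)} \<subseteq> (\<lambda>\<mu>. - inverse \<mu>) ` ?E" by blast
  then show ?thesis using finite_eigenvalues[OF g(1)] finite_subset by blast
qed

end

section \<open>Perturbing one operator by a product\<close>

text \<open>The sum im f + P. In the uses below, \<open>P\<close> is the contribution of the
  operators held fixed while \<open>f\<close> varies.\<close>

definition sum_im :: "('a \<Rightarrow> 'b::plus) \<Rightarrow> 'b set \<Rightarrow> 'b set" where
  "sum_im f P = {f x + y | x y. y \<in> P}"

lemma sum_imI: "y \<in> P \<Longrightarrow> f x + y \<in> sum_im f P"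
  by (auto simp: sum_im_def)

text \<open>Polynomials with coefficients in the module model its finitely supported sequences, with
  scalars acting coefficientwise.\<close>

lemma vector_space_map_poly:
  assumes "vector_space s"
  shows "vector_space (\<lambda>c. map_poly (s c))"
proof -
  interpret vector_space s by fact
  show ?thesis
    by unfold_locales (auto intro!: poly_eqI simp: coeff_map_poly scale_right_distrib scale_left_distrib)
qed

locale algebra_module =
  R: Modules.module act + S: finite_dimensional_vector_space scale Basis
  for act :: "'r::comm_ring_1 \<Rightarrow> 'm::ab_group_add \<Rightarrow> 'm"
    and scale :: "'k::field \<Rightarrow> 'm \<Rightarrow> 'm" and Basis :: "'m set" +
  assumes act_scale: "act a (scale c x) = scale c (act a x)"
begin

lemma linear_act: "Vector_Spaces.linear scale scale (act a)"
  unfolding Vector_Spaces.linear_iff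
  by (simp add: S.vector_space_axioms R.scale_right_distrib act_scale)

text \<open>The preimage of \<open>P\<close> maps onto im f \<inter> P with kernel ker f; the
  dimension formula for sums does the rest. For fixed \<open>P\<close>, comparing sums thus becomes
  comparing preimages, which the sequence spaces below compute.\<close>

lemma dim_sum_im:
  assumes f: "Vector_Spaces.linear scale scale f" and P: "S.subspace P"
  shows "S.dim (sum_im f P) + S.dim {x. f x \<in> P} = S.dim UNIV + S.dim P"
proof -
  interpret e: vector_space_pair scale scale by unfold_locales
  interpret f: Vector_Spaces.linear scale scale f by fact
  have *: "S.dim Z = S.dim (f ` Z) + S.dim {x \<in> Z. f x = 0}" if "S.subspace Z" for Z
    by (rule e.dim_image_kernel(2)[OF f that S.finite_Basis _ S.finite_Basis]) (simp_all add: S.span_Basis)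
  have 1: "{x \<in> {x. f x \<in> P}. f x = 0} = {x \<in> UNIV. f x = 0}"
    using S.subspace_0[OF P] by auto
  have 2: "f ` {x. f x \<in> P} = range f \<inter> P" by auto
  have 3: "sum_im f P = {x + y | x y. x \<in> range f \<and> y \<in> P}"
    unfolding sum_im_def by blast
  have "S.dim {x. f x \<in> P} = S.dim (range f \<inter> P) + S.dim {x \<in> UNIV. f x = 0}"
    using *[OF f.subspace_linear_preimage[OF P]] unfolding 1 2 .
  moreover have "S.dim UNIV = S.dim (range f) + S.dim {x \<in> UNIV. f x = 0}"
    using *[OF S.subspace_UNIV] .
  moreover have "S.dim (sum_im f P) + S.dim (range f \<inter> P) = S.dim (range f) + S.dim P"
    unfolding 3 by (rule S.dim_sums_Int[OF f.subspace_image[OF S.subspace_UNIV] P])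
  ultimately show ?thesis by linarith
qed

lemma subspace_sum_im:
  assumes f: "Vector_Spaces.linear scale scale f" and P: "S.subspace P"
  shows "S.subspace (sum_im f P)"
proof -
  interpret f: Vector_Spaces.linear scale scale f by fact
  have "sum_im f P = {x + y | x y. x \<in> range f \<and> y \<in> P}"
    unfolding sum_im_def by blast
  then show ?thesis using S.subspace_sums[OF f.subspace_image[OF S.subspace_UNIV] P] by simp
qed

lemma linear_pencil: "Vector_Spaces.linear scale scale (\<lambda>x. act a x + scale t (act b x))"
  unfolding Vector_Spaces.linear_iff
  by (auto simp: S.vector_space_axioms R.scale_right_distrib act_scale S.scale_right_distrib mult.commute)

text \<open>For \<open>t \<noteq> 0\<close> the chain forces every \<open>b f_i\<close> into im(a +
  t b) + P, so adjoining it to \<open>P\<close> changes nothing there. By semicontinuity the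
  enlarged sum at 0 is no bigger than at a generic \<open>t\<close>, and maximality leaves no room
  for growth at 0.\<close>

lemma image_of_maximal_pencil:
  assumes inf: "infinite (UNIV :: 'k set)" and P: "S.subspace P"
    and max: "\<And>t. S.dim (sum_im (\<lambda>x. act a x + scale t (act b x)) P) \<le> S.dim (sum_im (act a) P)"
    and chain: "\<And>i. act a (coeff f i) + act b (coeff f (Suc i)) \<in> P"
  shows "act b (coeff f k) \<in> sum_im (act a) P"
proof -
  define Z where "Z t = sum_im (\<lambda>x. act a x + scale t (act b x)) P" for t
  define z where "z = act b (coeff f k)"
  define Z' where "Z' t = sum_im (\<lambda>x. act a x + scale t (act b x)) (S.span (insert z P))" for t
  have subZ: "S.subspace (Z t)" and subZ': "S.subspace (Z' t)" for t
    unfolding Z_def Z'_def by (rule subspace_sum_im[OF linear_pencil]; simp add: P)+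
  have PZ: "y \<in> Z t" if "y \<in> P" for y t
    using sum_imI[OF that, of "\<lambda>x. act a x + scale t (act b x)" 0] by (simp add: Z_def)
  have imZ: "act a x + scale t (act b x) \<in> Z t" for x t
    using sum_imI[OF S.subspace_0[OF P], of "\<lambda>x. act a x + scale t (act b x)" x] by (simp add: Z_def)
  \<comment> \<open>Downward induction from above the degree, where coefficients vanish; the chain
    relation isolates \<open>t b f_i\<close>, and \<open>t\<close> is invertible.\<close>
  have step: "act b (coeff f i) \<in> Z t" if "t \<noteq> 0" for t i
  proof (induction "Suc (degree f) - i" arbitrary: i)
    case 0
    then have "coeff f i = 0" by (simp add: coeff_eq_0)
    then show ?case using S.subspace_0[OF subZ] by simp
  next
    case (Suc d)
    then have "act b (coeff f (Suc i)) \<in> Z t" by simp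
    then have "(act a (coeff f i) + scale t (act b (coeff f i)))
        - (act a (coeff f i) + act b (coeff f (Suc i))) + act b (coeff f (Suc i)) \<in> Z t"
      using imZ PZ[OF chain] subZ by (blast intro: S.subspace_add S.subspace_diff)
    then have "scale t (act b (coeff f i)) \<in> Z t" by simp
    then have "scale (inverse t) (scale t (act b (coeff f i))) \<in> Z t"
      by (rule S.subspace_scale[OF subZ])
    then show ?case using that by simp
  qed
  have "finite {t. S.dim (Z' t) < S.dim (Z' 0)}"
  proof (rule S.finite_dim_drop[OF subZ'])
    fix c assume "c \<in> Z' 0"
    then obtain x y where "c = act a x + y" "y \<in> S.span (insert z P)"
      by (auto simp: Z'_def sum_im_def)
    then have "c + scale t (act b x) \<in> Z' t" for t
      using sum_imI[of y _ "\<lambda>x. act a x + scale t (act b x)" x] by (simp add: Z'_def ac_simps)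
    then show "\<exists>d. \<forall>t. c + scale t d \<in> Z' t" by blast
  qed
  then have "infinite (UNIV - insert 0 {t. S.dim (Z' t) < S.dim (Z' 0)})"
    using inf by (meson Diff_infinite_finite finite_insert)
  then obtain t where t: "t \<noteq> 0" "S.dim (Z' 0) \<le> S.dim (Z' t)"
    by (metis (mono_tags, lifting) Diff_iff infinite_imp_nonempty insertCI mem_Collect_eq ex_in_conv not_less)
  have "S.span (insert z P) \<subseteq> Z t"
    using PZ step[OF t(1)] by (intro S.span_minimal subZ) (auto simp: z_def)
  then have "Z' t \<subseteq> Z t"
    using imZ subZ S.subspace_add unfolding Z'_def sum_im_def by blast
  then have "S.dim (Z' t) \<le> S.dim (Z t)" by (rule S.dim_subset)
  moreover have "S.dim (Z t) \<le> S.dim (Z 0)" using max[of t] by (simp add: Z_def)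
  ultimately have "S.dim (Z' 0) \<le> S.dim (Z 0)" using t(2) by linarith
  moreover have "Z 0 \<subseteq> Z' 0"
    unfolding Z_def Z'_def sum_im_def using S.span_superset[of "insert z P"] by blast
  ultimately have "Z' 0 = Z 0"
    using S.subspace_dim_equal[OF subZ[of 0] subZ'[of 0]] by simp
  moreover have "z \<in> Z' 0"
    using sum_imI[OF S.span_base[of z "insert z P"], of "\<lambda>x. act a x + scale 0 (act b x)" 0]
    by (simp add: Z'_def)
  ultimately show ?thesis by (simp add: Z_def z_def)
qed

text \<open>
  The idea is to substitute \<open>t = g\<close> in the pencil \<open>a + t b\<close>.  By maximality at \<open>t = 0\<close>, the shift
  \<open>S\<close> is surjective on the space \<open>K\<close> of finitely supported sequences \<open>f\<close> with
  \<open>a f\<^sub>i + b f\<^sub>i\<^sub>+\<^sub>1 \<in> P\<close>.  In characteristic \<open>p\<close> we have \<open>(S - g)\<^sup>p = S\<^sup>p - g\<^sup>p = S\<^sup>p\<close>, so \<open>T = S - g\<close> is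
  surjective too and \<open>p \<cdot> dim (ker T) = dim (ker T\<^sup>p) = dim (ker S\<^sup>p) = p \<cdot> dim (ker S)\<close>.  Reading off
  the constant term identifies \<open>ker S\<close> with the preimage of \<open>P\<close> under \<open>a\<close>, and \<open>ker T\<close> with the
  preimage of \<open>P\<close> under \<open>a + g b\<close>.
\<close>

lemma dim_sum_im_perturb:
  assumes char: "prime CHAR('r)" and nil: "g ^ CHAR('r) = 0"
    and inf: "infinite (UNIV :: 'k set)"
    and P: "S.subspace P" and gP: "\<And>x. x \<in> P \<Longrightarrow> act g x \<in> P"
    and max: "\<And>t. S.dim (sum_im (\<lambda>x. act a x + scale t (act b x)) P) \<le> S.dim (sum_im (act a) P)"
  shows "S.dim (sum_im (act (a + g * b)) P) = S.dim (sum_im (act a) P)"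
proof -
  define p where "p = CHAR('r)"
  have p0: "p > 0" using char prime_gt_0_nat by (simp add: p_def)
  interpret Q: vector_space "\<lambda>c. map_poly (scale c)"
    by (rule vector_space_map_poly) unfold_locales
  interpret c: vector_space_pair "\<lambda>c. map_poly (scale c)" scale by unfold_locales
  define K where "K = {f. \<forall>i. act a (coeff f i) + act b (coeff f (Suc i)) \<in> P}"
  \<comment> \<open>\<open>T 0\<close> is the shift and \<open>T g\<close> the shift minus
    \<open>g\<close>; a general \<open>h\<close> lets one computation serve both kernels.\<close>
  define T where "T h f = poly_shift 1 f - map_poly (act h) f" for h f
  have coeff_T: "coeff (T h f) i = coeff f (Suc i) - act h (coeff f i)" for h f i
    by (simp add: T_def coeff_poly_shift coeff_map_poly)
  have coeff_scale: "coeff (map_poly (scale c) f) i = scale c (coeff f i)" for c f i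
    by (simp add: coeff_map_poly)
  have linT: "Vector_Spaces.linear (\<lambda>c. map_poly (scale c)) (\<lambda>c. map_poly (scale c)) (T h)" for h
    unfolding Vector_Spaces.linear_iff
    by (auto intro!: poly_eqI Q.vector_space_axioms
        simp: coeff_T coeff_scale R.scale_right_distrib act_scale S.scale_right_diff_distrib)
  have lin0: "Vector_Spaces.linear (\<lambda>c. map_poly (scale c)) scale (\<lambda>f. coeff f 0)"
    unfolding Vector_Spaces.linear_iff
    by (auto intro!: Q.vector_space_axioms S.vector_space_axioms simp: coeff_scale)
  have subK: "Q.subspace K"
    unfolding Q.subspace_def K_def
  proof (safe)
    fix f h i assume "\<forall>i. act a (coeff f i) + act b (coeff f (Suc i)) \<in> P"
      "\<forall>i. act a (coeff h i) + act b (coeff h (Suc i)) \<in> P"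
    then have "(act a (coeff f i) + act b (coeff f (Suc i))) + (act a (coeff h i) + act b (coeff h (Suc i))) \<in> P"
      using P by (blast intro: S.subspace_add)
    then show "act a (coeff (f + h) i) + act b (coeff (f + h) (Suc i)) \<in> P"
      by (simp add: R.scale_right_distrib algebra_simps)
  next
    fix c f i assume "\<forall>i. act a (coeff f i) + act b (coeff f (Suc i)) \<in> P"
    then have "scale c (act a (coeff f i) + act b (coeff f (Suc i))) \<in> P"
      using P by (blast intro: S.subspace_scale)
    then show "act a (coeff (map_poly (scale c) f) i) + act b (coeff (map_poly (scale c) f) (Suc i)) \<in> P"
      by (simp add: coeff_scale act_scale S.scale_right_distrib)
  qed (use S.subspace_0[OF P] in simp)
  have TK: "T h f \<in> K" if f: "f \<in> K" and h: "\<And>x. x \<in> P \<Longrightarrow> act h x \<in> P" for h f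
  proof -
    have "(act a (coeff f (Suc i)) + act b (coeff f (Suc (Suc i)))) -
        act h (act a (coeff f i) + act b (coeff f (Suc i))) \<in> P" for i
      using f h P unfolding K_def by (blast intro: S.subspace_diff)
    then show ?thesis
      unfolding K_def
      by (simp add: coeff_T R.scale_right_diff_distrib R.scale_right_distrib R.scale_left_commute algebra_simps)
  qed
  have TKon: "(T h ^^ j) f \<in> K" if "f \<in> K" and "\<And>x. x \<in> P \<Longrightarrow> act h x \<in> P" for h f j
    by (induction j) (use that TK in auto)
  \<comment> \<open>Shift and \<open>act h\<close> commute, so a power of \<open>T h\<close> is
    \<open>(X - h) ^ j\<close> evaluated at the shift. The p-th power can then be computed in the
    polynomial ring over \<open>'r\<close>.\<close>
  have coeff_Tpow: "coeff ((T h ^^ j) f) i = (\<Sum>n\<le>j. act (coeff ([:- h, 1:] ^ j) n) (coeff f (i + n)))" for h j f i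
  proof (induction j arbitrary: i)
    case (Suc j)
    let ?q = "[:- h, 1:] ^ j"
    have deg: "coeff ?q n = 0" if "n > j" for n
      using degree_power_le[of "[:- h, 1:]" j] that by (intro coeff_eq_0) auto
    have "coeff ((T h ^^ Suc j) f) i =
        (\<Sum>n\<le>j. act (coeff ?q n) (coeff f (i + Suc n))) - (\<Sum>n\<le>j. act (h * coeff ?q n) (coeff f (i + n)))"
      by (simp add: coeff_T Suc R.scale_sum_right)
    also have "(\<Sum>n\<le>j. act (coeff ?q n) (coeff f (i + Suc n))) =
        (\<Sum>n\<le>Suc j. act (coeff (pCons 0 ?q) n) (coeff f (i + n)))"
      by (subst sum.atMost_Suc_shift) simp
    also have "(\<Sum>n\<le>j. act (h * coeff ?q n) (coeff f (i + n))) =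
        (\<Sum>n\<le>Suc j. act (h * coeff ?q n) (coeff f (i + n)))"
      using deg[of "Suc j"] by simp
    also have "(\<Sum>n\<le>Suc j. act (coeff (pCons 0 ?q) n) (coeff f (i + n))) -
        (\<Sum>n\<le>Suc j. act (h * coeff ?q n) (coeff f (i + n))) =
        (\<Sum>n\<le>Suc j. act (coeff ([:- h, 1:] ^ Suc j) n) (coeff f (i + n)))"
      unfolding sum_subtractf[symmetric]
      by (rule sum.cong) (simp_all add: R.scale_left_diff_distrib algebra_simps)
    finally show ?case .
  qed simp
  have Tp: "T g ^^ p = T 0 ^^ p"
  proof (intro ext poly_eqI)
    fix f i
    have pc: "[:- h, 1:] ^ p = monom 1 p" if "h ^ p = 0" for h :: 'r
    proof -
      have "[:- h, 1:] = [:- h:] + monom 1 1" by (simp add: monom_altdef)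
      then have "[:- h, 1:] ^ p = [:- h:] ^ p + monom 1 1 ^ p"
        using freshmans_dream[of p "[:- h:]" "monom 1 1"] char by (simp add: p_def)
      also have "[:- h:] ^ p = 0"
        using that power_minus[of h p] by (simp add: poly_const_pow)
      finally show ?thesis by (simp add: monom_power)
    qed
    have *: "coeff ((T h ^^ p) f) i = coeff f (i + p)" if "h ^ p = 0" for h
    proof -
      have "coeff ((T h ^^ p) f) i = (\<Sum>n\<le>p. if n = p then coeff f (i + p) else 0)"
        unfolding coeff_Tpow pc[OF that] by (rule sum.cong) auto
      then show ?thesis by simp
    qed
    show "coeff ((T g ^^ p) f) i = coeff ((T 0 ^^ p) f) i"
      using *[of g] *[of 0] nil zero_power[OF p0] unfolding p_def by metis
  qed
  \<comment> \<open>A preimage under the shift needs a new constant coefficient \<open>c\<close>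
    with \<open>a c + b f_0\<close> in \<open>P\<close>; maximality provides it as
    \<open>- x\<close>.\<close>
  have S_onto: "T 0 ` K = K"
  proof (intro equalityI subsetI)
    fix f assume f: "f \<in> K"
    have "act b (coeff f 0) \<in> sum_im (act a) P"
      using f by (intro image_of_maximal_pencil[OF inf P max]) (auto simp: K_def)
    then obtain x y where xy: "act b (coeff f 0) = act a x + y" "y \<in> P"
      unfolding sum_im_def by blast
    have "act a (coeff (pCons (- x) f) i) + act b (coeff (pCons (- x) f) (Suc i)) \<in> P" for i
      using f xy by (cases i) (auto simp: K_def)
    then have "pCons (- x) f \<in> K" unfolding K_def by blast
    moreover have "T 0 (pCons (- x) f) = f"
      by (rule poly_eqI) (simp add: coeff_T)
    ultimately show "f \<in> T 0 ` K" by (metis imageI)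
  qed (use TK S.subspace_0[OF P] in auto)
  have Spow_onto: "(T 0 ^^ j) ` K = K" for j
    by (induction j) (simp_all only: funpow.simps image_comp[symmetric] S_onto image_id id_apply image_ident)
  \<comment> \<open>The p-th powers of \<open>T g\<close> and of the shift agree and the latter is
    onto, so the outermost factor \<open>T g\<close> is onto.\<close>
  have T_onto: "T g ` K = K"
  proof (intro equalityI subsetI)
    fix f assume "f \<in> K"
    then obtain h where h: "h \<in> K" "f = (T g ^^ p) h" using Spow_onto[of p] Tp by auto
    obtain q where q: "p = Suc q" using p0 gr0_implies_Suc by blast
    show "f \<in> T g ` K"
      using h(2) TKon[OF h(1) gP, of q] unfolding q by auto
  qed (use TK gP in auto)
  \<comment> \<open>A sequence killed by \<open>T h\<close> is geometric, with terms
    \<open>h ^ i x\<close>, and finitely supported as \<open>h\<close> is nilpotent. Its conditions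
    for \<open>K\<close> are the \<open>h ^ i\<close> multiples of the single one that
    \<open>(a + h b) x\<close> lies in \<open>P\<close>.\<close>
  have ker: "(\<exists>A. finite A \<and> {f \<in> K. T h f = 0} \<subseteq> Q.span A) \<and>
      Q.dim {f \<in> K. T h f = 0} = S.dim {x. act (a + h * b) x \<in> P}" 
      if hp: "h ^ p = 0" and hP: "\<And>x. x \<in> P \<Longrightarrow> act h x \<in> P" for h
  proof -
    let ?Z = "{f \<in> K. T h f = 0}"
    have cf: "coeff f i = act (h ^ i) (coeff f 0)" if "T h f = 0" for f i
    proof (induction i)
      case (Suc i)
      have "coeff f (Suc i) - act h (coeff f i) = 0" using that coeff_T[of h f i] by simp
      then show ?case using Suc by simp
    qed simp
    have subZ: "Q.subspace ?Z"
    proof -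
      interpret t: Vector_Spaces.linear "\<lambda>c. map_poly (scale c)" "\<lambda>c. map_poly (scale c)" "T h" by (rule linT)
      have "?Z = K \<inter> {f. T h f = 0}" by auto
      then show ?thesis using Q.subspace_inter[OF subK t.subspace_kernel] by simp
    qed
    have Z0: "{f \<in> ?Z. coeff f 0 = 0} = {0}"
    proof -
      have "f = 0" if "T h f = 0" "coeff f 0 = 0" for f
        using cf[OF that(1)] that(2) by (intro poly_eqI) simp
      moreover have "0 \<in> ?Z" using Q.subspace_0[OF subZ] .
      ultimately show ?thesis by auto
    qed
    have im: "(\<lambda>f. coeff f 0) ` ?Z = {x. act (a + h * b) x \<in> P}"
    proof (intro equalityI subsetI)
      fix x assume "x \<in> (\<lambda>f. coeff f 0) ` ?Z"
      then obtain f where f: "f \<in> K" "T h f = 0" "x = coeff f 0" by blast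
      then have "act a (coeff f 0) + act b (coeff f 1) \<in> P" by (auto simp: K_def)
      then show "x \<in> {x. act (a + h * b) x \<in> P}"
        using cf[OF f(2), of 1] f(3) by (simp add: R.scale_left_distrib mult.commute)
    next
      fix x assume x: "x \<in> {x. act (a + h * b) x \<in> P}"
      define f where "f = (\<Sum>i<p. monom (act (h ^ i) x) i)"
      have cff: "coeff f i = act (h ^ i) x" for i
      proof -
        have "coeff f i = (\<Sum>j<p. if j = i then act (h ^ i) x else 0)"
          unfolding f_def coeff_sum by (rule sum.cong) auto
        moreover have "h ^ i = 0" if "\<not> i < p"
          using hp that power_add[of h p "i - p"] by simp
        ultimately show ?thesis by auto
      qed
      have "act (h ^ i) (act (a + h * b) x) \<in> P" for i
      proof (induction i)
        case (Suc i)
        then show ?case using hP[OF Suc] by (simp add: mult.assoc)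
      qed (use x in simp)
      moreover have "act a (coeff f i) + act b (coeff f (Suc i)) = act (h ^ i) (act (a + h * b) x)" for i
        by (simp add: cff R.scale_left_distrib R.scale_right_distrib distrib_left mult_ac)
      ultimately have "f \<in> K" unfolding K_def by simp
      moreover have "T h f = 0"
        by (rule poly_eqI) (simp add: coeff_T cff)
      ultimately show "x \<in> (\<lambda>f. coeff f 0) ` ?Z"
        using cff[of 0] by (auto intro!: image_eqI[of _ _ f])
    qed
    note RN = c.dim_image_kernel[OF lin0 subZ finite.emptyI _ S.finite_Basis, unfolded im Z0]
    have "Q.dim {0} = 0" using Q.dim_le_card[of "{0}" "{}"] by simp
    then show ?thesis using RN by (simp add: S.span_Basis)
  qed
  have g0: "g ^ p = 0" "0 ^ p = (0::'r)" using nil zero_power[OF p0] by (simp_all add: p_def)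
  obtain A where A: "finite A" "{f \<in> K. T g f = 0} \<subseteq> Q.span A" using ker[OF g0(1) gP] by blast
  obtain B where B: "finite B" "{f \<in> K. T 0 f = 0} \<subseteq> Q.span B" using ker[OF g0(2)] S.subspace_0[OF P] by auto
  have "p * Q.dim {f \<in> K. T g f = 0} = p * Q.dim {f \<in> K. T 0 f = 0}"
    using Q.dim_kernel_power[OF linT subK T_onto A, of p] Q.dim_kernel_power[OF linT subK S_onto B, of p]
    unfolding Tp by metis
  then have "S.dim {x. act (a + g * b) x \<in> P} = S.dim {x. act a x \<in> P}"
    using p0 ker[OF g0(1) gP] ker[OF g0(2)] S.subspace_0[OF P] by simp
  then show ?thesis
    using dim_sum_im[OF linear_act P, of "a + g * b"] dim_sum_im[OF linear_act P, of a] by linarith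
qed

end

section \<open>The radical of the group algebra\<close>

interpretation ring: Modules.module "(*) :: 'a::comm_ring_1 \<Rightarrow> 'a \<Rightarrow> 'a"
  by unfold_locales (auto simp: algebra_simps)

text \<open>Induction on \<open>G\<close> absorbs g N into the ideal, which therefore has to vary.
  The induction hypothesis gives N \<subseteq> I + g N; iterating, N \<subseteq> I + g^k N, and the
  last term vanishes for large k.\<close>

lemma nilpotent_nakayama:
  fixes G :: "'a::comm_ring_1 set"
  assumes "finite G" and "\<And>g. g \<in> G \<Longrightarrow> \<exists>m. g ^ m = 0"
    and N: "ring.subspace N" and "ring.subspace I"
    and "N \<subseteq> ring.span (I \<union> {g * n | g n. g \<in> G \<and> n \<in> N})"
  shows "N \<subseteq> I"
  using assms(1,2,4,5)
proof (induction G arbitrary: I rule: finite_induct)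
  case empty
  then show ?case by (simp add: ring.span_eq_iff[THEN iffD2])
next
  case (insert g G)
  define I' where "I' = {i + g * n | i n. i \<in> I \<and> n \<in> N}"
  have gN: "ring.subspace ((*) g ` N)"
    unfolding ring.subspace_def
  proof safe
    show "0 \<in> (*) g ` N"
      using ring.subspace_0[OF N] by (intro image_eqI[of _ _ 0]) simp_all
    show "g * x + g * y \<in> (*) g ` N" if "x \<in> N" "y \<in> N" for x y
      using ring.subspace_add[OF N that] by (intro image_eqI[of _ _ "x + y"]) (simp_all add: distrib_left)
    show "c * (g * x) \<in> (*) g ` N" if "x \<in> N" for c x
      using ring.subspace_scale[OF N that] by (intro image_eqI[of _ _ "c * x"]) (simp_all add: mult.left_commute)
  qed
  have "I' = {x + y | x y. x \<in> I \<and> y \<in> (*) g ` N}" unfolding I'_def by blast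
  then have I': "ring.subspace I'"
    using ring.span_Un[of I "(*) g ` N"] insert.prems(2) gN ring.subspace_span[of "I \<union> (*) g ` N"]
    by (simp add: ring.span_eq_iff[THEN iffD2])
  have "I \<union> {h * n | h n. h \<in> insert g G \<and> n \<in> N} \<subseteq> I' \<union> {h * n | h n. h \<in> G \<and> n \<in> N}"
  proof -
    have "i \<in> I'" if "i \<in> I" for i
      unfolding I'_def using that ring.subspace_0[OF N] by (intro CollectI exI[of _ i] exI[of _ 0]) simp
    moreover have "g * n \<in> I'" if "n \<in> N" for n
      unfolding I'_def using that ring.subspace_0[OF insert.prems(2)]
      by (intro CollectI exI[of _ 0] exI[of _ n]) simp
    ultimately show ?thesis by auto
  qed
  then have "N \<subseteq> ring.span (I' \<union> {h * n | h n. h \<in> G \<and> n \<in> N})"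
    using insert.prems(3) ring.span_mono by (meson subset_trans)
  then have NI': "N \<subseteq> I'" using insert.IH[OF _ I'] insert.prems(1) by simp
  have iter: "\<forall>x\<in>N. \<exists>i\<in>I. \<exists>n\<in>N. x = i + g ^ k * n" for k
  proof (induction k)
    case 0
    show ?case using ring.subspace_0[OF insert.prems(2)] by force
  next
    case (Suc k)
    show ?case
    proof
      fix x assume "x \<in> N"
      then obtain i n where 1: "i \<in> I" "n \<in> N" "x = i + g ^ k * n" using Suc by blast
      obtain j l where 2: "j \<in> I" "l \<in> N" "n = j + g * l" using NI' 1(2) unfolding I'_def by blast
      have "i + g ^ k * j \<in> I"
        using 1 2 insert.prems(2) by (intro ring.subspace_add ring.subspace_scale) auto
      moreover have "x = (i + g ^ k * j) + g ^ Suc k * l"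
        unfolding 1(3) 2(3) by (simp only: distrib_left power_Suc2 mult.assoc add.assoc)
      ultimately show "\<exists>i\<in>I. \<exists>n\<in>N. x = i + g ^ Suc k * n" using 2(2) by blast
    qed
  qed
  obtain m where "g ^ m = 0" using insert.prems(1) by blast
  then show ?case using iter[of m] by auto
qed

lemma CHAR_poly_mapping: "CHAR('e::monoid_add \<Rightarrow>\<^sub>0 'k::comm_semiring_1) = CHAR('k)"
proof (rule CHAR_eqI)
  show "of_nat CHAR('k) = (0 :: 'e \<Rightarrow>\<^sub>0 'k)"
    by (simp flip: single_of_nat)
next
  fix n assume "of_nat n = (0 :: 'e \<Rightarrow>\<^sub>0 'k)"
  then have "Poly_Mapping.lookup (of_nat n :: 'e \<Rightarrow>\<^sub>0 'k) 0 = 0" by simp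
  then show "CHAR('k) dvd n" by (simp add: lookup_of_nat of_nat_eq_0_iff_char_dvd)
qed

lemma single_power: "Poly_Mapping.single (g::'e::comm_monoid_add) (1::'k::comm_semiring_1) ^ n
    = Poly_Mapping.single (\<Sum>i<n. g) 1"
  by (induction n) (simp_all add: mult_single add.commute)

text \<open>Generators of the augmentation ideal \<open>ring.span aug_gens\<close>: a finite set, as
  the Nakayama argument requires.\<close>

definition aug_gens :: "('e::{ab_group_add, finite} \<Rightarrow>\<^sub>0 'k::field) set" where
  "aug_gens = range (\<lambda>g. Poly_Mapping.single g 1 - 1)"

lemma finite_aug_gens: "finite aug_gens"
  by (simp add: aug_gens_def)

lemma poly_mapping_decomp:
  fixes x :: "'e::{ab_group_add, finite} \<Rightarrow>\<^sub>0 'k::field"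
  shows "x - Poly_Mapping.single 0 (\<Sum>g\<in>UNIV. Poly_Mapping.lookup x g) \<in> ring.span aug_gens"
proof -
  have 1: "x = (\<Sum>g\<in>UNIV. Poly_Mapping.single g (Poly_Mapping.lookup x g))"
    by (rule poly_mapping_eqI) (simp add: lookup_sum lookup_single when_def)
  have 2: "Poly_Mapping.single 0 (\<Sum>g\<in>UNIV. Poly_Mapping.lookup x g) = (\<Sum>g\<in>UNIV. Poly_Mapping.single 0 (Poly_Mapping.lookup x g))"
    by (rule poly_mapping_eqI) (simp add: lookup_sum lookup_single when_def)
  have "x - Poly_Mapping.single 0 (\<Sum>g\<in>UNIV. Poly_Mapping.lookup x g) =
      (\<Sum>g\<in>UNIV. Poly_Mapping.single g (Poly_Mapping.lookup x g) - Poly_Mapping.single 0 (Poly_Mapping.lookup x g))"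
    using arg_cong2[OF 1 2, of "(-)"] by (simp only: sum_subtractf)
  also have "\<dots> = (\<Sum>g\<in>UNIV. Poly_Mapping.single 0 (Poly_Mapping.lookup x g) * (Poly_Mapping.single g 1 - 1))"
    by (rule sum.cong) (simp_all add: right_diff_distrib mult_single)
  also have "\<dots> \<in> ring.span aug_gens"
    by (intro ring.span_sum ring.span_scale ring.span_base) (auto simp: aug_gens_def)
  finally show ?thesis .
qed

context
  fixes p n :: nat
  assumes char: "CHAR('k::field) = p"
    and elem: "elementary_abelian p n TYPE('e::{ab_group_add, finite})"
begin

lemma prime_CHAR: "prime CHAR('e \<Rightarrow>\<^sub>0 'k)"
  using char elem by (simp add: CHAR_poly_mapping elementary_abelian_def)

text \<open>The p-th power map is additive and sends [g] to [p g] = 1, so it kills every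
  generator.\<close>

lemma aug_pth_power:
  assumes "x \<in> ring.span (aug_gens :: ('e \<Rightarrow>\<^sub>0 'k) set)"
  shows "x ^ CHAR('e \<Rightarrow>\<^sub>0 'k) = 0"
  using assms
proof (induction rule: ring.span_induct_alt)
  case base
  show ?case using prime_gt_0_nat[OF prime_CHAR] by (rule zero_power)
next
  case (step c x y)
  obtain g where g: "x = Poly_Mapping.single g 1 - 1" using step(1) by (auto simp: aug_gens_def)
  have "(x + 1) ^ CHAR('e \<Rightarrow>\<^sub>0 'k) = x ^ CHAR('e \<Rightarrow>\<^sub>0 'k) + 1 ^ CHAR('e \<Rightarrow>\<^sub>0 'k)"
    by (rule freshmans_dream[OF prime_CHAR refl])
  moreover have "(x + 1) ^ CHAR('e \<Rightarrow>\<^sub>0 'k) = 1"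
    using elem char by (simp add: g single_power CHAR_poly_mapping elementary_abelian_def)
  ultimately have "x ^ CHAR('e \<Rightarrow>\<^sub>0 'k) = 0" by simp
  then show ?case
    using freshmans_dream[OF prime_CHAR refl, of "c * x" y] step(2) by (simp add: power_mult_distrib)
qed

text \<open>The augmentation ideal is maximal: an ideal above it contains the augmentation of each
  of its elements as a constant, and a nonzero constant is a unit. This is the source of nilpotence
  of radical elements.\<close>

lemma jacobson_radical_subset_aug:
  "(jacobson_radical :: ('e \<Rightarrow>\<^sub>0 'k) set) \<subseteq> ring.span aug_gens"
proof -
  have "maximal_ideal (ring.span (aug_gens :: ('e \<Rightarrow>\<^sub>0 'k) set))"
    unfolding maximal_ideal_def ring_ideal_def
  proof (intro conjI allI impI)
    show "ring.span (aug_gens :: ('e \<Rightarrow>\<^sub>0 'k) set) \<noteq> UNIV"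
      using aug_pth_power[of 1] by auto
    fix I :: "('e \<Rightarrow>\<^sub>0 'k) set"
    assume I: "ring.subspace I" and sub: "ring.span aug_gens \<subseteq> I"
    show "I = ring.span aug_gens \<or> I = UNIV"
    proof (rule disjCI)
      assume "I \<noteq> UNIV"
      have "x \<in> ring.span aug_gens" if x: "x \<in> I" for x
      proof -
        define c where "c = (\<Sum>g\<in>UNIV. Poly_Mapping.lookup x g)"
        have dec: "x - Poly_Mapping.single 0 c \<in> ring.span aug_gens"
          unfolding c_def by (rule poly_mapping_decomp)
        have "x - (x - Poly_Mapping.single 0 c) \<in> I"
          by (rule ring.subspace_diff[OF I x subsetD[OF sub dec]])
        then have c: "Poly_Mapping.single 0 c \<in> I" by simp
        have "c = 0"
        proof (rule ccontr)
          assume "c \<noteq> 0"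
          have "y \<in> I" for y
            using ring.subspace_scale[OF I c, of "y * Poly_Mapping.single 0 (inverse c)"] \<open>c \<noteq> 0\<close>
            by (simp add: mult.assoc mult_single)
          then show False using \<open>I \<noteq> UNIV\<close> by blast
        qed
        then show ?thesis using dec by simp
      qed
      then show "I = ring.span aug_gens" using sub by blast
    qed
  qed simp
  then show ?thesis unfolding jacobson_radical_def by blast
qed

lemma jacobson_radical_pth_power:
  "x \<in> (jacobson_radical :: ('e \<Rightarrow>\<^sub>0 'k) set) \<Longrightarrow> x ^ CHAR('e \<Rightarrow>\<^sub>0 'k) = 0"
  using aug_pth_power jacobson_radical_subset_aug by blast

text \<open>Write b = v + j with v in \<open>V\<close> and j in Rad^2. Then a b is a v plus an
  element of the augmentation ideal times Rad^2, and Nakayama removes the second term.\<close>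

lemma jacobson_radical_sq_subset_span:
  fixes V :: "('e \<Rightarrow>\<^sub>0 'k) set"
  assumes "splitting V"
  shows "jacobson_radical_sq \<subseteq> ring.span {a * w | a w. a \<in> jacobson_radical \<and> w \<in> V}" (is "?J2 \<subseteq> ?I")
proof (rule nilpotent_nakayama[OF finite_aug_gens])
  show "\<exists>m. g ^ m = 0" if "g \<in> aug_gens" for g :: "'e \<Rightarrow>\<^sub>0 'k"
    using aug_pth_power[OF ring.span_base[OF that]] by blast
  let ?N = "ring.span (?I \<union> {g * n | g n. g \<in> aug_gens \<and> n \<in> ?J2})"
  have "{a * b | a b. a \<in> jacobson_radical \<and> b \<in> jacobson_radical} \<subseteq> ?N"
    proof safe
      fix a b :: "'e \<Rightarrow>\<^sub>0 'k" assume a: "a \<in> jacobson_radical" and b: "b \<in> jacobson_radical"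
      obtain v where v: "v \<in> V" "rad_proj b = rad_proj v"
        using assms b unfolding splitting_def bij_betw_def by blast
      have j: "b - v \<in> ?J2" using v(2) rad_proj_eq_iff by blast
      have "a * (b - v) \<in> ?N"
        using subsetD[OF jacobson_radical_subset_aug a]
      proof (induction rule: ring.span_induct_alt)
        case (step c x y)
        have "x * (b - v) \<in> ?N" using step(1) j by (intro ring.span_base) blast
        then have "c * (x * (b - v)) + y * (b - v) \<in> ?N"
          using step(2) by (rule ring.span_add[OF ring.span_scale])
        then show ?case by (simp only: distrib_right mult.assoc)
      qed (simp add: ring.span_zero)
      moreover have "a * v \<in> ?N" using a v(1) by (intro ring.span_base UnI1) blast
      ultimately have "a * v + a * (b - v) \<in> ?N" by (intro ring.span_add)
      then show "a * b \<in> ?N" unfolding distrib_left[symmetric] by simp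
    qed
  then show "?J2 \<subseteq> ?N"
    by (subst (1) jacobson_radical_sq_def) (rule ring.span_minimal[OF _ ring.subspace_span])
qed (simp_all add: jacobson_radical_sq_def)

end

section \<open>Radicals along planes\<close>

text \<open>Euclid's argument: over a finite field the product of all X - a, plus 1, would have no
  root.\<close>

lemma infinite_UNIV_alg_closed: "infinite (UNIV :: 'a::alg_closed_field set)"
proof
  assume fin: "finite (UNIV :: 'a set)"
  define P where "P = (\<Prod>a\<in>(UNIV :: 'a set). [:- a, 1:])"
  have "degree P = (\<Sum>a\<in>(UNIV :: 'a set). degree [:- a, 1:])"
    unfolding P_def by (rule degree_prod_eq_sum_degree) simp
  then have "degree P > 0" using fin by (simp add: finite_UNIV_card_ge_0)
  then have "degree (P + 1) > 0" by (simp add: degree_add_eq_left)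
  then obtain x where "poly (P + 1) x = 0" using alg_closed_imp_poly_has_root by blast
  moreover have "poly P x = 0"
    unfolding P_def poly_prod using fin by (intro prod_zero) auto
  ultimately show False by simp
qed

lemma finite_dimensional_from_finite_span:
  assumes "vector_space s" and "finite A" and "module.span s A = UNIV"
  shows "\<exists>B. finite_dimensional_vector_space s B"
proof -
  interpret vector_space s by fact
  obtain B where B: "B \<subseteq> UNIV" "independent B" "UNIV \<subseteq> span B" using basis_exists by metis
  then have "finite B" using independent_span_bound[OF assms(2) B(2)] assms(3) by simp
  then have "finite_dimensional_vector_space s B"
    using B by unfold_locales auto
  then show ?thesis by blast
qed

lemma finite_dimensional_kE:
  "\<exists>B. finite_dimensional_vector_space
    (alg_scale :: 'k::field \<Rightarrow> ('e::{ab_group_add, finite} \<Rightarrow>\<^sub>0 'k) \<Rightarrow> ('e \<Rightarrow>\<^sub>0 'k)) B"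
proof (rule finite_dimensional_from_finite_span)
  show "vector_space (alg_scale :: 'k \<Rightarrow> ('e \<Rightarrow>\<^sub>0 'k) \<Rightarrow> ('e \<Rightarrow>\<^sub>0 'k))"
    by (rule kE.vector_space_axioms)
  show "finite (range (\<lambda>g. Poly_Mapping.single g 1 :: 'e \<Rightarrow>\<^sub>0 'k))" by simp
  have "x \<in> kE.span (range (\<lambda>g. Poly_Mapping.single g 1))" for x :: "'e \<Rightarrow>\<^sub>0 'k"
  proof -
    have "x = (\<Sum>g\<in>UNIV. alg_scale (Poly_Mapping.lookup x g) (Poly_Mapping.single g 1))"
      by (rule poly_mapping_eqI) (simp add: alg_scale_def mult_single lookup_sum lookup_single when_def)
    also have "\<dots> \<in> kE.span (range (\<lambda>g. Poly_Mapping.single g 1))"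
      by (intro kE.span_sum kE.span_scale kE.span_base) auto
    finally show ?thesis .
  qed
  then show "kE.span (range (\<lambda>g. Poly_Mapping.single g 1 :: 'e \<Rightarrow>\<^sub>0 'k)) = UNIV" by blast
qed

text \<open>Values of \<open>f\<close> off \<open>V\<close> are arbitrary; extending from a basis of
  \<open>V\<close> makes facts about globally linear maps available.\<close>

lemma (in vector_space_pair) linear_between_extend:
  assumes "vs1.subspace V" and "linear_between s1 s2 V W f"
  shows "\<exists>g. Vector_Spaces.linear s1 s2 g \<and> (\<forall>x\<in>V. g x = f x)"
proof -
  obtain B where B: "B \<subseteq> V" "vs1.independent B" "V \<subseteq> vs1.span B"
    using vs1.basis_exists by metis
  obtain g where g: "Vector_Spaces.linear s1 s2 g" "\<forall>x\<in>B. g x = f x"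
    using linear_independent_extend[OF B(2)] by blast
  interpret g: Vector_Spaces.linear s1 s2 g by fact
  have "x \<in> V \<and> g x = f x" if "x \<in> vs1.span B" for x
    using that
  proof (induction rule: vs1.span_induct_alt)
    case base
    have "f (s1 0 0) = s2 0 (f 0)"
      using assms vs1.subspace_0 unfolding linear_between_def by blast
    then show ?case using vs1.subspace_0[OF assms(1)] by simp
  next
    case (step c x y)
    then have x: "x \<in> V" "s1 c x \<in> V" and y: "y \<in> V" using B(1) assms(1) vs1.subspace_scale by auto
    then have "f (s1 c x + y) = s2 c (f x) + f y"
      using assms(2) unfolding linear_between_def by simp
    then show ?case
      using g(2) step x y vs1.subspace_add[OF assms(1)] by (simp add: g.add g.scale)
  qed
  then show ?thesis using g(1) B(3) by blast
qed

text \<open>The tuple version of \<open>Rad_plane\<close>: entries can be altered one at a time, may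
  be dependent, and may leave the splitting.\<close>

definition tuple_rad :: "('r \<Rightarrow> 'm \<Rightarrow> 'm::comm_monoid_add) \<Rightarrow> nat \<Rightarrow> (nat \<Rightarrow> 'r) \<Rightarrow> 'm set" where
  "tuple_rad act r x = range (\<lambda>m. \<Sum>i<r. act (x i) (m i))"

lemma tuple_rad_cong: "(\<And>i. i < r \<Longrightarrow> x i = y i) \<Longrightarrow> tuple_rad act r x = tuple_rad act r y"
  unfolding tuple_rad_def by simp

locale kE_module = algebra_module act "mod_scale act" Basis
  for act :: "('e::{ab_group_add, finite} \<Rightarrow>\<^sub>0 'k::field) \<Rightarrow> 'm::ab_group_add \<Rightarrow> 'm" and Basis
begin

lemma act_alg_scale: "act (alg_scale t b) m = mod_scale act t (act b m)"
  by (simp add: alg_scale_def mod_scale_def)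

lemma subspace_tuple_rad: "S.subspace (tuple_rad act r x)"
  unfolding S.subspace_def tuple_rad_def
proof safe
  show "0 \<in> range (\<lambda>m. \<Sum>i<r. act (x i) (m i))"
    by (rule image_eqI[of _ _ "\<lambda>i. 0"]) simp_all
  show "(\<Sum>i<r. act (x i) (m i)) + (\<Sum>i<r. act (x i) (m' i)) \<in> range (\<lambda>m. \<Sum>i<r. act (x i) (m i))" for m m'
    by (rule image_eqI[of _ _ "\<lambda>i. m i + m' i"]) (simp_all add: R.scale_right_distrib sum.distrib)
  show "mod_scale act c (\<Sum>i<r. act (x i) (m i)) \<in> range (\<lambda>m. \<Sum>i<r. act (x i) (m i))" for c m
    by (rule image_eqI[of _ _ "\<lambda>i. mod_scale act c (m i)"]) (simp_all add: S.scale_sum_right act_scale)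
qed

lemma Rad_plane_span: "Rad_plane act (kE.span (u ` {..<r})) = tuple_rad act r u"
proof
  have gen: "act x m \<in> tuple_rad act r u" if "x \<in> kE.span (u ` {..<r})" for x m
    using that
  proof (induction rule: kE.span_induct_alt)
    case base
    then show ?case using S.subspace_0[OF subspace_tuple_rad] by simp
  next
    case (step c x y)
    then obtain i where i: "i < r" "x = u i" by blast
    have "act x m \<in> tuple_rad act r u"
      unfolding tuple_rad_def
    proof (rule image_eqI[of _ _ "\<lambda>j. if j = i then m else 0"])
      show "act x m = (\<Sum>j<r. act (u j) (if j = i then m else 0))"
        using i by (simp add: if_distrib[of "act _"] cong: if_cong)
    qed simp
    then show ?case
      using step(2) S.subspace_add[OF subspace_tuple_rad S.subspace_scale[OF subspace_tuple_rad]]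
      by (simp add: R.scale_left_distrib act_alg_scale)
  qed
  show "Rad_plane act (kE.span (u ` {..<r})) \<subseteq> tuple_rad act r u"
    unfolding Rad_plane_def by (rule S.span_minimal[OF _ subspace_tuple_rad]) (use gen in auto)
  show "tuple_rad act r u \<subseteq> Rad_plane act (kE.span (u ` {..<r}))"
  proof
    fix z assume "z \<in> tuple_rad act r u"
    then obtain m where z: "z = (\<Sum>i<r. act (u i) (m i))" by (auto simp: tuple_rad_def)
    show "z \<in> Rad_plane act (kE.span (u ` {..<r}))"
      unfolding z Rad_plane_def
    proof (intro S.span_sum S.span_base)
      fix i assume "i \<in> {..<r}"
      then have "u i \<in> kE.span (u ` {..<r})" by (intro kE.span_base) simp
      then show "act (u i) (m i) \<in> (\<Union>x\<in>kE.span (u ` {..<r}). range (act x))" by blast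
    qed
  qed
qed

text \<open>Zeroing slot \<open>i\<close> isolates the contribution of the other entries, which
  becomes the fixed \<open>P\<close> of the pencil argument.\<close>

lemma tuple_rad_split:
  assumes "i < r"
  shows "tuple_rad act r x = sum_im (act (x i)) (tuple_rad act r (x(i := 0)))"
proof
  have *: "(\<Sum>j<r. act (x j) (m j)) = act (x i) (m i) + (\<Sum>j<r. act ((x(i := 0)) j) (m j))" for m
  proof -
    have "(\<Sum>j<r. act ((x(i := 0)) j) (m j)) = (\<Sum>j\<in>{..<r} - {i}. act (x j) (m j))"
      using assms by (subst sum.remove[of _ i]) auto
    then show ?thesis using assms sum.remove[of "{..<r}" i "\<lambda>j. act (x j) (m j)"] by simp
  qed
  show "tuple_rad act r x \<subseteq> sum_im (act (x i)) (tuple_rad act r (x(i := 0)))"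
    unfolding tuple_rad_def sum_im_def using * by blast
  show "sum_im (act (x i)) (tuple_rad act r (x(i := 0))) \<subseteq> tuple_rad act r x"
  proof
    fix z assume "z \<in> sum_im (act (x i)) (tuple_rad act r (x(i := 0)))"
    then obtain m0 m where z: "z = act (x i) m0 + (\<Sum>j<r. act ((x(i := 0)) j) (m j))"
      by (auto simp: sum_im_def tuple_rad_def)
    have "(\<Sum>j<r. act ((x(i := 0)) j) (m j)) = (\<Sum>j<r. act ((x(i := 0)) j) ((m(i := m0)) j))"
      by (rule sum.cong) auto
    then have "z = (\<Sum>j<r. act (x j) ((m(i := m0)) j))"
      using z *[of "m(i := m0)"] by simp
    then show "z \<in> tuple_rad act r x" unfolding tuple_rad_def by blast
  qed
qed

text \<open>With the vectors \<open>m i\<close> held fixed, the sum varies affinely in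
  \<open>t\<close>, so \<open>finite_dim_drop\<close> applies after recentring the parameter at
  \<open>s\<close>.\<close>

lemma finite_tuple_rad_drop:
  "finite {t. S.dim (tuple_rad act r (\<lambda>i. x i + alg_scale t (v i))) <
    S.dim (tuple_rad act r (\<lambda>i. x i + alg_scale s (v i)))}"
proof -
  define Z where "Z t = tuple_rad act r (\<lambda>i. x i + alg_scale (s + t) (v i))" for t
  have "finite {t. S.dim (Z t) < S.dim (Z 0)}"
  proof (rule S.finite_dim_drop)
    show "S.subspace (Z t)" for t unfolding Z_def by (rule subspace_tuple_rad)
    fix c assume "c \<in> Z 0"
    then obtain m where c: "c = (\<Sum>i<r. act (x i + alg_scale s (v i)) (m i))"
      by (auto simp: Z_def tuple_rad_def)
    have "c + mod_scale act t (\<Sum>i<r. act (v i) (m i)) = (\<Sum>i<r. act (x i + alg_scale (s + t) (v i)) (m i))" for t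
      unfolding c S.scale_sum_right sum.distrib[symmetric]
      by (simp add: R.scale_left_distrib act_alg_scale S.scale_left_distrib add.assoc)
    then show "\<exists>d. \<forall>t. c + mod_scale act t d \<in> Z t"
      unfolding Z_def tuple_rad_def by blast
  qed
  then have "finite ((+) s ` {t. S.dim (Z t) < S.dim (Z 0)})" by (rule finite_imageI)
  moreover have "{t. S.dim (tuple_rad act r (\<lambda>i. x i + alg_scale t (v i))) <
    S.dim (tuple_rad act r (\<lambda>i. x i + alg_scale s (v i)))} \<subseteq> (+) s ` {t. S.dim (Z t) < S.dim (Z 0)}"
  proof safe
    fix t assume "S.dim (tuple_rad act r (\<lambda>i. x i + alg_scale t (v i))) <
      S.dim (tuple_rad act r (\<lambda>i. x i + alg_scale s (v i)))"
    then show "t \<in> (+) s ` {t. S.dim (Z t) < S.dim (Z 0)}"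
      by (intro image_eqI[of _ _ "t - s"]) (simp_all add: Z_def)
  qed
  ultimately show ?thesis by (rule finite_subset[rotated])
qed

text \<open>All translates by \<open>V\<close> count, including dependent tuples, and
  \<open>x\<close> itself may lie outside \<open>V\<close>; this is what lets the notion survive
  perturbation.\<close>

definition dim_maximal :: "nat \<Rightarrow> ('e \<Rightarrow>\<^sub>0 'k) set \<Rightarrow> (nat \<Rightarrow> 'e \<Rightarrow>\<^sub>0 'k) \<Rightarrow> bool" where
  "dim_maximal r V x \<longleftrightarrow> (\<forall>v. (\<forall>i<r. v i \<in> V) \<longrightarrow>
     S.dim (tuple_rad act r (\<lambda>i. x i + v i)) \<le> S.dim (tuple_rad act r x))"

lemma dim_maximalD:
  assumes "dim_maximal r V x" and "\<And>i. i < r \<Longrightarrow> v i \<in> V"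
  shows "S.dim (tuple_rad act r (\<lambda>i. x i + v i)) \<le> S.dim (tuple_rad act r x)"
  using assms unfolding dim_maximal_def by simp

section \<open>Nilpotent perturbation of a maximal tuple\<close>

context
  fixes r :: nat and V :: "('e \<Rightarrow>\<^sub>0 'k) set"
  assumes prime: "prime CHAR('e \<Rightarrow>\<^sub>0 'k)" and inf: "infinite (UNIV :: 'k set)"
    and V: "kE.subspace V"
begin

lemma dim_tuple_rad_perturb:
  assumes x: "dim_maximal r V x" and "i < r" and g: "g ^ CHAR('e \<Rightarrow>\<^sub>0 'k) = 0" and w: "w \<in> V"
  shows "S.dim (tuple_rad act r (x(i := x i + g * w))) = S.dim (tuple_rad act r x)"
proof -
  let ?P = "tuple_rad act r (x(i := 0))"
  have "S.dim (sum_im (act (x i + g * w)) ?P) = S.dim (sum_im (act (x i)) ?P)"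
  proof (rule dim_sum_im_perturb[OF prime g inf subspace_tuple_rad])
    fix y assume "y \<in> ?P"
    then obtain m where "y = (\<Sum>j<r. act ((x(i := 0)) j) (m j))" by (auto simp: tuple_rad_def)
    then have "act g y = (\<Sum>j<r. act ((x(i := 0)) j) (act g (m j)))"
      by (simp only: R.scale_sum_right R.scale_left_commute)
    then show "act g y \<in> ?P"
      unfolding tuple_rad_def by (intro image_eqI[of _ _ "\<lambda>j. act g (m j)"]) auto
  next
    fix t
    \<comment> \<open>The pencil at \<open>t\<close> is translation by \<open>t w\<close> in slot
      \<open>i\<close>, so maximality under \<open>V\<close> bounds it.\<close>
    define v where "v j = (if j = i then alg_scale t w else 0)" for j
    have "sum_im (\<lambda>m. act (x i) m + mod_scale act t (act w m)) ?P = tuple_rad act r (\<lambda>j. x j + v j)"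
    proof -
      have "(\<lambda>m. act (x i) m + mod_scale act t (act w m)) = act (x i + v i)"
        by (simp add: fun_eq_iff v_def R.scale_left_distrib act_alg_scale)
      moreover have "(\<lambda>j. x j + v j)(i := 0) = x(i := 0)" by (auto simp: v_def)
      ultimately show ?thesis using tuple_rad_split[OF \<open>i < r\<close>, of "\<lambda>j. x j + v j"] by simp
    qed
    moreover have "v j \<in> V" for j
      using kE.subspace_scale[OF V w] kE.subspace_0[OF V] by (simp add: v_def)
    ultimately show "S.dim (sum_im (\<lambda>m. act (x i) m + mod_scale act t (act w m)) ?P) \<le> S.dim (sum_im (act (x i)) ?P)"
      using dim_maximalD[OF x] tuple_rad_split[OF \<open>i < r\<close>, of x] by simp
  qed
  then show ?thesis
    using tuple_rad_split[OF \<open>i < r\<close>, of x] tuple_rad_split[OF \<open>i < r\<close>, of "x(i := x i + g * w)"] by simp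
qed

text \<open>
  Along the lines \<open>x + t v\<close> and \<open>x' + t v\<close>, where \<open>x'\<close> is the perturbed tuple, all but finitely
  many \<open>t\<close> do at least as well as \<open>t = 0\<close> and \<open>t = 1\<close> respectively, so both can be compared at a
  common \<open>t\<close>.
\<close>

lemma dim_maximal_perturb:
  assumes x: "dim_maximal r V x" and "i < r" and g: "g ^ CHAR('e \<Rightarrow>\<^sub>0 'k) = 0" and w: "w \<in> V"
  shows "dim_maximal r V (x(i := x i + g * w))"
  unfolding dim_maximal_def
proof (intro allI impI)
  fix v assume v: "\<forall>i<r. v i \<in> V"
  let ?x' = "x(i := x i + g * w)"
  let ?d = "\<lambda>x. S.dim (tuple_rad act r x)"
  let ?l = "\<lambda>x t i. x i + alg_scale t (v i)"
  have "finite ({t. ?d (?l x t) < ?d (?l x 0)} \<union> {t. ?d (?l ?x' t) < ?d (?l ?x' 1)})"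
    by (intro finite_UnI finite_tuple_rad_drop)
  then obtain t where "t \<notin> {t. ?d (?l x t) < ?d (?l x 0)} \<union> {t. ?d (?l ?x' t) < ?d (?l ?x' 1)}"
    using inf by (meson ex_new_if_finite)
  then have t: "?d x \<le> ?d (?l x t)" "?d (\<lambda>i. ?x' i + v i) \<le> ?d (?l ?x' t)"
    by (simp_all only: Un_iff mem_Collect_eq not_less de_Morgan_disj kE.scale_zero_left kE.scale_one add_0_right)
  \<comment> \<open>Translations by \<open>V\<close> compose and the dimension at
    \<open>x + t v\<close> is at least that at \<open>x\<close>, so maximality is inherited.\<close>
  have "dim_maximal r V (?l x t)"
    unfolding dim_maximal_def
  proof (intro allI impI)
    fix v' assume v': "\<forall>i<r. v' i \<in> V"
    have "?d (\<lambda>i. x i + (alg_scale t (v i) + v' i)) \<le> ?d x"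
      using v v' kE.subspace_add[OF V kE.subspace_scale[OF V]] by (intro dim_maximalD[OF x]) blast
    then show "?d (\<lambda>i. ?l x t i + v' i) \<le> ?d (?l x t)"
      using t(1) by (simp only: add.assoc)
  qed
  then have "?d ((?l x t)(i := ?l x t i + g * w)) = ?d (?l x t)"
    by (rule dim_tuple_rad_perturb[OF _ \<open>i < r\<close> g w])
  \<comment> \<open>Perturbing and translating commute, so \<open>x' + t v\<close> is the
    perturbation of a maximal tuple.\<close>
  moreover have "(?l x t)(i := ?l x t i + g * w) = ?l ?x' t"
    by (auto simp: add_ac)
  moreover have "?d (?l x t) \<le> ?d x"
    using v kE.subspace_scale[OF V] by (intro dim_maximalD[OF x]) blast
  ultimately have "?d (?l ?x' t) \<le> ?d x" by simp
  then show "?d (\<lambda>i. ?x' i + v i) \<le> ?d ?x'"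
    using t(2) dim_tuple_rad_perturb[OF x \<open>i < r\<close> g w] by linarith
qed

text \<open>The summands \<open>c * a * w\<close> are added one by one, with \<open>c * a\<close> as
  nilpotent factor. Maximality accompanies the dimension because each further summand needs
  it.\<close>

lemma dim_maximal_perturb_span:
  assumes J: "\<And>a c. a \<in> J \<Longrightarrow> (c * a) ^ CHAR('e \<Rightarrow>\<^sub>0 'k) = 0"
    and q: "q \<in> ring.span {a * w | a w. a \<in> J \<and> w \<in> V}"
    and x: "dim_maximal r V x" and "i < r"
  shows "dim_maximal r V (x(i := x i + q)) \<and>
    S.dim (tuple_rad act r (x(i := x i + q))) = S.dim (tuple_rad act r x)"
  using q
proof (induction rule: ring.span_induct_alt)
  case base
  show ?case using x by simp
next
  case (step c z y)
  then obtain a w where z: "z = a * w" and a: "a \<in> J" and w: "w \<in> V" by blast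
  let ?y = "x(i := x i + y)"
  have *: "x i + (c * z + y) = x i + y + c * a * w"
    by (simp only: z mult.assoc add.assoc add.commute[of y])
  have eq: "x(i := x i + (c * z + y)) = ?y(i := ?y i + (c * a) * w)"
    unfolding * fun_upd_upd fun_upd_same ..
  show ?case
    unfolding eq
    using step(2) dim_maximal_perturb[OF _ \<open>i < r\<close> J[OF a] w, of ?y]
      dim_tuple_rad_perturb[OF _ \<open>i < r\<close> J[OF a] w, of ?y] by metis
qed

lemma dim_tuple_rad_perturb_all:
  assumes J: "\<And>a c. a \<in> J \<Longrightarrow> (c * a) ^ CHAR('e \<Rightarrow>\<^sub>0 'k) = 0"
    and q: "\<And>i. i < r \<Longrightarrow> q i \<in> ring.span {a * w | a w. a \<in> J \<and> w \<in> V}"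
    and x: "dim_maximal r V x"
  shows "S.dim (tuple_rad act r (\<lambda>i. x i + q i)) = S.dim (tuple_rad act r x)"
proof -
  \<comment> \<open>Only the first \<open>k\<close> entries are corrected, so consecutive tuples
    differ in a single slot.\<close>
  define y where "y k i = (if i < k then x i + q i else x i)" for k i
  have "dim_maximal r V (y k) \<and> S.dim (tuple_rad act r (y k)) = S.dim (tuple_rad act r x)" if "k \<le> r" for k
    using that
  proof (induction k)
    case 0
    have "y 0 = x" by (simp add: y_def fun_eq_iff)
    then show ?case using x by simp
  next
    case (Suc k)
    have "y (Suc k) = (y k)(k := y k k + q k)"
      by (auto simp: y_def fun_eq_iff)
    then show ?case using Suc dim_maximal_perturb_span[OF J q, of k "y k" k] by (simp only: Suc_le_eq less_imp_le)
  qed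
  moreover have "tuple_rad act r (y r) = tuple_rad act r (\<lambda>i. x i + q i)"
    by (rule tuple_rad_cong) (simp add: y_def)
  ultimately show ?thesis by (metis order_refl)
qed

end

end

section \<open>Maximal planes and their images under \<psi>\<close>

lemma ordered_basis_exists:
  assumes "vector_space s" and "U \<in> Grass s r V" and "r \<ge> 1"
  shows "\<exists>u. ordered_basis s r U u"
proof -
  interpret vector_space s by fact
  have U: "subspace U" "dim U = r" using assms(2) by (auto simp: Grass_def)
  obtain B where B: "B \<subseteq> U" "independent B" "U \<subseteq> span B" "card B = dim U" by (rule basis_exists)
  \<comment> \<open>As \<open>r \<ge> 1\<close>, the basis has positive \<open>card\<close> and
    cannot be infinite.\<close>
  have "finite B" using B(4) U(2) assms(3) by (intro card_ge_0_finite) simp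
  then obtain u where u: "bij_betw u {..<r} B"
    using ex_bij_betw_nat_finite[of B] B(4) U(2) by (auto simp: atLeast0LessThan)
  have "span B = U" using B U by (simp add: span_subspace)
  then have "ordered_basis s r U u"
    using u B(2) by (simp add: ordered_basis_def bij_betw_def)
  then show ?thesis by blast
qed

lemma kE_module_exists:
  fixes act :: "('e::{ab_group_add, finite} \<Rightarrow>\<^sub>0 'k::field) \<Rightarrow> 'm::ab_group_add \<Rightarrow> 'm"
  assumes "fin_dim_module act"
  shows "\<exists>Basis. kE_module act Basis"
proof -
  have m: "Modules.module act" using assms by (simp add: fin_dim_module_def)
  interpret M: Modules.module act by fact
  obtain A where "finite A" "module.span (mod_scale act) A = UNIV"
    using assms by (auto simp: fin_dim_module_def)
  then obtain Basis where "finite_dimensional_vector_space (mod_scale act) Basis"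
    using finite_dimensional_from_finite_span[OF vector_space_mod_scale[OF m]] by blast
  then have "kE_module act Basis"
    by (intro kE_module.intro algebra_module.intro m algebra_module_axioms.intro)
      (simp_all add: mod_scale_def mult.commute)
  then show ?thesis by blast
qed

lemma rad_dim_splitting_iso:
  fixes V W :: "('e::{ab_group_add, finite} \<Rightarrow>\<^sub>0 'k::alg_closed_field) set"
    and act :: "('e \<Rightarrow>\<^sub>0 'k) \<Rightarrow> 'm::ab_group_add \<Rightarrow> 'm"
  assumes char: "CHAR('k) = p" and elem: "elementary_abelian p n TYPE('e)"
    and V: "splitting V" and iso: "splitting_iso V W \<psi>"
    and r: "1 \<le> r" and M: "fin_dim_module act"
    and U: "U \<in> Grass alg_scale r V"
    and max: "\<And>U'. U' \<in> Grass alg_scale r V \<Longrightarrow> rad_dim act U' \<le> rad_dim act U"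
  shows "rad_dim act (\<psi> ` U) = rad_dim act U"
proof -
  obtain Basis where "kE_module act Basis" using kE_module_exists[OF M] by blast
  then interpret kE_module act Basis .
  obtain B where "finite_dimensional_vector_space (alg_scale :: 'k \<Rightarrow> ('e \<Rightarrow>\<^sub>0 'k) \<Rightarrow> _) B"
    using finite_dimensional_kE by blast
  then interpret fd: finite_dimensional_vector_space "alg_scale :: 'k \<Rightarrow> ('e \<Rightarrow>\<^sub>0 'k) \<Rightarrow> _" B .
  interpret pair: vector_space_pair "alg_scale :: 'k \<Rightarrow> ('e \<Rightarrow>\<^sub>0 'k) \<Rightarrow> _" "alg_scale :: 'k \<Rightarrow> ('e \<Rightarrow>\<^sub>0 'k) \<Rightarrow> _"
    by unfold_locales
  have inf: "infinite (UNIV :: 'k set)" by (rule infinite_UNIV_alg_closed)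
  have prime: "prime CHAR('e \<Rightarrow>\<^sub>0 'k)" by (rule prime_CHAR[OF char elem])
  have subV: "kE.subspace V" using V by (simp add: splitting_def)
  obtain u where u: "ordered_basis alg_scale r U u"
    using ordered_basis_exists[OF kE.vector_space_axioms U r] by blast
  then have spanU: "kE.span (u ` {..<r}) = U" by (simp add: ordered_basis_def)
  have UV: "U \<subseteq> V" using U by (simp add: Grass_def)
  have uV: "u i \<in> V" if "i < r" for i
    using that UV spanU kE.span_base[of "u i" "u ` {..<r}"] by auto
  have rad_u: "rad_dim act U = S.dim (tuple_rad act r u)"
    unfolding rad_dim_def spanU[symmetric] Rad_plane_span ..
  \<comment> \<open>A translate of \<open>u\<close> may be dependent and span no r-plane. On the
    line from \<open>u\<close> through it, a generic \<open>t\<close> gives an r-plane in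
    \<open>V\<close> whose radical is at least as large as at t = 1, and \<open>max\<close> bounds
    that radical.\<close>
  have good: "dim_maximal r V u"
    unfolding dim_maximal_def
  proof (intro allI impI)
    fix v assume v: "\<forall>i<r. v i \<in> V"
    define X where "X t = kE.span ((\<lambda>i. u i + alg_scale t (v i)) ` {..<r})" for t
    have X0: "X 0 = U" by (simp add: X_def spanU)
    have "finite {t. kE.dim (X t) < kE.dim (X 0)}"
    proof (rule fd.finite_dim_drop)
      show "kE.subspace (X t)" for t by (simp add: X_def)
      fix c assume "c \<in> X 0"
      then have "c \<in> kE.span (u ` {..<r})" by (simp add: X0 spanU)
      \<comment> \<open>For c = \<Sum> a_i u_i the direction is d = \<Sum> a_i v_i.\<close>
      then show "\<exists>d. \<forall>t. c + alg_scale t d \<in> X t"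
      proof (induction rule: kE.span_induct_alt)
        case base
        have "\<forall>t. 0 + alg_scale t 0 \<in> X t" by (simp add: X_def kE.span_zero)
        then show ?case by blast
      next
        case (step a z y)
        then obtain i d where i: "i < r" "z = u i" and d: "\<forall>t. y + alg_scale t d \<in> X t" by blast
        have *: "u i + alg_scale t (v i) \<in> X t" for t
          unfolding X_def using i by (intro kE.span_base) simp
        have "alg_scale a (u i + alg_scale t (v i)) + (y + alg_scale t d) \<in> X t" for t
          using *[of t] spec[OF d, of t] unfolding X_def by (rule kE.span_add[OF kE.span_scale])
        then have "\<forall>t. alg_scale a z + y + alg_scale t (alg_scale a (v i) + d) \<in> X t"
          by (simp add: i kE.scale_right_distrib kE.scale_left_commute add_ac mult.commute)
        then show ?case by blast
      qed
    qed
    then have "finite ({t. kE.dim (X t) < kE.dim (X 0)} \<union>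
        {t. S.dim (tuple_rad act r (\<lambda>i. u i + alg_scale t (v i))) <
            S.dim (tuple_rad act r (\<lambda>i. u i + alg_scale 1 (v i)))})"
      by (rule finite_UnI[OF _ finite_tuple_rad_drop])
    then obtain t where "t \<notin> {t. kE.dim (X t) < kE.dim (X 0)} \<union>
        {t. S.dim (tuple_rad act r (\<lambda>i. u i + alg_scale t (v i))) <
            S.dim (tuple_rad act r (\<lambda>i. u i + alg_scale 1 (v i)))}"
      using inf by (meson ex_new_if_finite)
    then have t: "kE.dim U \<le> kE.dim (X t)"
        "S.dim (tuple_rad act r (\<lambda>i. u i + v i)) \<le> S.dim (tuple_rad act r (\<lambda>i. u i + alg_scale t (v i)))"
      by (simp_all add: X0 not_less)
    have "kE.dim (X t) \<le> card ((\<lambda>i. u i + alg_scale t (v i)) ` {..<r})"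
      unfolding X_def by (rule kE.dim_le_card) auto
    also have "\<dots> \<le> r" using card_image_le[of "{..<r}"] by simp
    finally have "kE.dim (X t) = r" using t(1) U by (simp add: Grass_def)
    moreover have "X t \<subseteq> V"
      unfolding X_def using v
      by (intro kE.span_minimal subV)
        (auto intro!: kE.subspace_add[OF subV] kE.subspace_scale[OF subV] uV)
    ultimately have "X t \<in> Grass alg_scale r V" by (simp add: Grass_def X_def)
    then have "rad_dim act (X t) \<le> rad_dim act U" by (rule max)
    then show "S.dim (tuple_rad act r (\<lambda>i. u i + v i)) \<le> S.dim (tuple_rad act r u)"
      using t(2) rad_u unfolding rad_dim_def X_def Rad_plane_span by linarith
  qed
  obtain g where g: "Vector_Spaces.linear alg_scale alg_scale g" "\<forall>x\<in>V. g x = \<psi> x"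
    using pair.linear_between_extend[OF subV] iso unfolding splitting_iso_def by blast
  interpret g: Vector_Spaces.linear alg_scale alg_scale g by (rule g(1))
  have "\<psi> ` U = g ` U" using g(2) UV by (intro image_cong) auto
  also have "\<dots> = kE.span ((\<lambda>i. g (u i)) ` {..<r})"
    using g.span_image[of "u ` {..<r}"] by (simp add: spanU image_image)
  finally have "rad_dim act (\<psi> ` U) = S.dim (tuple_rad act r (\<lambda>i. g (u i)))"
    by (simp add: rad_dim_def Rad_plane_span)
  also have "tuple_rad act r (\<lambda>i. g (u i)) = tuple_rad act r (\<lambda>i. u i + (\<psi> (u i) - u i))"
    by (rule tuple_rad_cong) (use g(2) uV in simp)
  also have "S.dim \<dots> = S.dim (tuple_rad act r u)"
  proof (rule dim_tuple_rad_perturb_all[OF prime inf subV _ _ good])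
    fix a c :: "'e \<Rightarrow>\<^sub>0 'k" assume "a \<in> jacobson_radical"
    then show "(c * a) ^ CHAR('e \<Rightarrow>\<^sub>0 'k) = 0"
      using jacobson_radical_pth_power[OF char elem] by (simp add: power_mult_distrib)
  next
    fix i assume "i < r"
    then have "\<psi> (u i) - u i \<in> jacobson_radical_sq"
      using iso uV rad_proj_eq_iff unfolding splitting_iso_def by blast
    then show "\<psi> (u i) - u i \<in> ring.span {a * w | a w. a \<in> jacobson_radical \<and> w \<in> V}"
      using jacobson_radical_sq_subset_span[OF char elem V] by blast
  qed
  finally show ?thesis by (simp add: rad_u)
qed

section \<open>Linear isomorphisms of Grassmannians\<close>

text \<open>Forms take infinite sequences, but the determinants read only the first \<open>r\<close>
  entries; applying a bijection after its inverse restores a basis only on those indices.\<close>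

lemma pluecker_form_cong:
  assumes "pluecker_form s r V d F" and "\<And>i. i < r \<Longrightarrow> u i = u' i"
  shows "F u = F u'"
  using assms(1)
proof induction
  case (mult d F l)
  have "Matrix.mat r r (\<lambda>(i, j). l i (u j)) = Matrix.mat r r (\<lambda>(i, j). l i (u' j))"
    by (rule cong_mat) (simp_all add: assms(2))
  then show ?case using mult by (simp add: pluecker_def)
qed simp_all

text \<open>A linear form on \<open>W\<close> composed with \<open>f\<close> is a linear form on
  \<open>V\<close>, so Pluecker coordinates pull back to Pluecker coordinates.\<close>

lemma pluecker_form_compose:
  assumes f: "linear_between s t V W f" and "pluecker_form t r W d F"
  shows "pluecker_form s r V d (\<lambda>u. F (\<lambda>i. f (u i)))"
  using assms(2)
proof induction
  case (mult d F l)
  have "linear_between s (*) V UNIV (\<lambda>x. l i (f x))" if "i < r" for i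
    using f mult(2)[OF that] unfolding linear_between_def by (auto simp: Pi_iff)
  moreover have "pluecker r l (\<lambda>i. f (u i)) = pluecker r (\<lambda>i x. l i (f x)) u" for u
    by (simp add: pluecker_def)
  ultimately show ?case
    using pluecker_form.mult[OF mult(3), of "\<lambda>i x. l i (f x)"] by simp
qed (auto intro: pluecker_form.intros)

lemma topspace_zariski: "topspace (zariski s r V) = Grass s r V"
proof
  show "topspace (zariski s r V) \<subseteq> Grass s r V"
    by (auto simp: zariski_def nonvanishing_def)
  have "Grass s r V = nonvanishing s r V (\<lambda>u. 1)" by (simp add: nonvanishing_def)
  moreover have "pluecker_form s r V 0 (\<lambda>u. 1)" by (rule pluecker_form.const)
  ultimately show "Grass s r V \<subseteq> topspace (zariski s r V)"
    unfolding zariski_def topology_generated_by_topspace by blast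
qed

lemma linear_between_inv_into:
  assumes "vector_space s" and V: "module.subspace s V"
    and f: "linear_between s t V W f" and bij: "bij_betw f V W"
  shows "linear_between t s W V (inv_into V f)"
proof -
  interpret vector_space s by fact
  have inv: "inv_into V f x \<in> V" "f (inv_into V f x) = x" if "x \<in> W" for x
    using that bij by (auto simp: bij_betw_def inv_into_into f_inv_into_f)
  show ?thesis
    unfolding linear_between_def
  proof (intro conjI ballI allI)
    show "inv_into V f \<in> W \<rightarrow> V" using inv by auto
    fix x assume x: "x \<in> W"
    show "inv_into V f (x + y) = inv_into V f x + inv_into V f y" if y: "y \<in> W" for y
    proof (rule inv_into_f_eq)
      show "inv_into V f x + inv_into V f y \<in> V" using inv x y subspace_add[OF V] by blast
      show "f (inv_into V f x + inv_into V f y) = x + y"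
        using f inv x y unfolding linear_between_def by simp
    qed (use bij in \<open>simp add: bij_betw_def\<close>)
    show "inv_into V f (t c x) = s c (inv_into V f x)" for c
    proof (rule inv_into_f_eq)
      show "s c (inv_into V f x) \<in> V" using inv x subspace_scale[OF V] by blast
      show "f (s c (inv_into V f x)) = t c x"
        using f inv x unfolding linear_between_def by simp
    qed (use bij in \<open>simp add: bij_betw_def\<close>)
  qed
qed

context vector_space_pair
begin

lemma Grass_image:
  assumes V: "vs1.subspace V" and f: "linear_between s1 s2 V W f" and inj: "inj_on f V"
    and U: "U \<in> Grass s1 r V"
  shows "f ` U \<in> Grass s2 r W"
    and "ordered_basis s1 r U u \<Longrightarrow> ordered_basis s2 r (f ` U) (\<lambda>i. f (u i))"
proof -
  have U': "vs1.subspace U" "U \<subseteq> V" "vs1.dim U = r" using U by (auto simp: Grass_def)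
  obtain g where g: "Vector_Spaces.linear s1 s2 g" "\<forall>x\<in>V. g x = f x"
    using linear_between_extend[OF V f] by blast
  interpret g: Vector_Spaces.linear s1 s2 g by fact
  have fg: "f ` U = g ` U" using g(2) U'(2) by (intro image_cong) auto
  have injg: "inj_on g U"
    using inj g(2) U'(2) unfolding inj_on_def by (metis subsetD)
  have "f ` U \<subseteq> W" using f U'(2) by (auto simp: linear_between_def)
  then show "f ` U \<in> Grass s2 r W"
    using g.subspace_image[OF U'(1)] dim_inj_image[OF g(1) U'(1) injg] U'(3) fg by (simp add: Grass_def)
  assume u: "ordered_basis s1 r U u"
  have uU: "u i \<in> U" if "i < r" for i
    using that u vs1.span_base[of "u i" "u ` {..<r}"] by (auto simp: ordered_basis_def)
  have fu: "(\<lambda>i. f (u i)) ` {..<r} = g ` u ` {..<r}"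
    unfolding image_image using subsetD[OF U'(2) uU] g(2) by (intro image_cong) auto
  show "ordered_basis s2 r (f ` U) (\<lambda>i. f (u i))"
    unfolding ordered_basis_def fu
  proof (intro conjI)
    have "inj_on (f \<circ> u) {..<r}"
      using u uU U'(2) inj by (intro comp_inj_on inj_on_subset[OF inj]) (auto simp: ordered_basis_def)
    then show "inj_on (\<lambda>i. f (u i)) {..<r}" by (simp add: comp_def)
    show "vs2.independent (g ` u ` {..<r})"
      using u injg by (intro g.independent_injective_image) (auto simp: ordered_basis_def)
    show "vs2.span (g ` u ` {..<r}) = f ` U"
      using u fg g.span_image[of "u ` {..<r}"] by (simp add: ordered_basis_def)
  qed
qed

text \<open>Pulling back along \<open>f\<close> keeps forms and their degrees, hence takes basic
  open sets to basic open sets and local quotients to local quotients.\<close>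

lemma variety_morphism_image:
  assumes V: "vs1.subspace V" and W: "vs2.subspace W"
    and f: "linear_between s1 s2 V W f" and bij: "bij_betw f V W"
    and X: "X \<subseteq> Grass s1 r V" and XY: "\<And>U. U \<in> X \<Longrightarrow> f ` U \<in> Y"
  shows "variety_morphism s1 r V X s2 r W Y ((`) f)"
proof -
  interpret inv: vector_space_pair s2 s1 by unfold_locales
  have inj: "inj_on f V" using bij by (simp add: bij_betw_def)
  have lin': "linear_between s2 s1 W V (inv_into V f)"
    by (rule linear_between_inv_into[OF vs1.vector_space_axioms V f bij])
  have inj': "inj_on (inv_into V f) W"
    using bij_betw_inv_into[OF bij] by (simp add: bij_betw_def)
  have nonvan: "f ` U \<in> nonvanishing s2 r W F \<longleftrightarrow> U \<in> nonvanishing s1 r V (\<lambda>u. F (\<lambda>i. f (u i)))"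
    if F: "pluecker_form s2 r W d F" and U: "U \<in> Grass s1 r V" for F d U
  proof -
    \<comment> \<open>Every ordered basis \<open>w\<close> of the image plane comes from one of
      \<open>U\<close> through the inverse map, up to entries of index at least
      \<open>r\<close>.\<close>
    have "(\<forall>w. ordered_basis s2 r (f ` U) w \<longrightarrow> F w \<noteq> 0) \<longleftrightarrow>
        (\<forall>u. ordered_basis s1 r U u \<longrightarrow> F (\<lambda>i. f (u i)) \<noteq> 0)"
    proof safe
      fix w assume all: "\<forall>u. ordered_basis s1 r U u \<longrightarrow> F (\<lambda>i. f (u i)) \<noteq> 0"
        and w: "ordered_basis s2 r (f ` U) w" and Fw: "F w = 0"
      have UV: "U \<subseteq> V" using U by (simp add: Grass_def)
      have "inv_into V f ` f ` U = U"
        using inv_into_image_cancel[OF inj UV] .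
      then have "ordered_basis s1 r U (\<lambda>i. inv_into V f (w i))"
        using inv.Grass_image(2)[OF W lin' inj' Grass_image(1)[OF V f inj U] w] by simp
      then have "F (\<lambda>i. f (inv_into V f (w i))) \<noteq> 0" using all by blast
      moreover have "f (inv_into V f (w i)) = w i" if "i < r" for i
      proof -
        have "w i \<in> f ` U"
          using w that vs2.span_base[of "w i" "w ` {..<r}"] by (auto simp: ordered_basis_def)
        then show ?thesis using UV by (intro f_inv_into_f) blast
      qed
      ultimately show False
        using pluecker_form_cong[OF F, of "\<lambda>i. f (inv_into V f (w i))" w] Fw by simp
    qed (use Grass_image(2)[OF V f inj U] in blast)
    then show ?thesis
      using U Grass_image(1)[OF V f inj U] by (simp add: nonvanishing_def)
  qed
  have cont0: "continuous_map (zariski s1 r V) (zariski s2 r W) ((`) f)"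
    unfolding zariski_def[of s2]
  proof (rule continuous_on_generated_topo)
    fix N assume "N \<in> {nonvanishing s2 r W F | F d. pluecker_form s2 r W d F}"
    then obtain F d where N: "N = nonvanishing s2 r W F" and F: "pluecker_form s2 r W d F" by blast
    have "(`) f -` N \<inter> topspace (zariski s1 r V) = nonvanishing s1 r V (\<lambda>u. F (\<lambda>i. f (u i)))"
      unfolding N topspace_zariski using nonvan[OF F] by (auto simp: nonvanishing_def)
    also have "openin (zariski s1 r V) \<dots>"
      unfolding zariski_def
      using pluecker_form_compose[OF f F] by (intro topology_generated_by_Basis) blast
    finally show "openin (zariski s1 r V) ((`) f -` N \<inter> topspace (zariski s1 r V))" .
  next
    have "\<Union> {nonvanishing s2 r W F | F d. pluecker_form s2 r W d F} = Grass s2 r W"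
      using topspace_zariski[of s2 r W] by (simp add: zariski_def)
    then show "(`) f ` topspace (zariski s1 r V) \<subseteq> \<Union> {nonvanishing s2 r W F | F d. pluecker_form s2 r W d F}"
      using Grass_image(1)[OF V f inj] by (auto simp: topspace_zariski)
  qed
  have cont: "continuous_map (subtopology (zariski s1 r V) X) (subtopology (zariski s2 r W) Y) ((`) f)"
    using continuous_map_from_subtopology[OF cont0] XY
    by (auto simp: continuous_map_in_subtopology topspace_zariski)
  show ?thesis
    unfolding variety_morphism_def
  proof (intro conjI allI impI cont)
    fix A \<phi> assume A: "openin (subtopology (zariski s2 r W) Y) A" and \<phi>: "regular_on s2 r W Y A \<phi>"
    show "regular_on s1 r V X (X \<inter> (`) f -` A) (\<lambda>U. \<phi> (f ` U))"
      unfolding regular_on_def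
    proof
      fix U assume U: "U \<in> X \<inter> (`) f -` A"
      then obtain N d F G where N: "openin (subtopology (zariski s2 r W) Y) N" "f ` U \<in> N" "N \<subseteq> A"
        and F: "pluecker_form s2 r W d F" and G: "pluecker_form s2 r W d G"
        and quot: "\<forall>U'\<in>N. \<forall>u. ordered_basis s2 r U' u \<longrightarrow> G u \<noteq> 0 \<and> \<phi> U' = F u / G u"
        using \<phi> unfolding regular_on_def by (metis IntD2 vimageD)
      let ?N = "{U \<in> X. f ` U \<in> N}"
      have "{U \<in> topspace (subtopology (zariski s1 r V) X). f ` U \<in> N} = ?N"
        using X by (auto simp: topspace_zariski)
      then have "openin (subtopology (zariski s1 r V) X) ?N"
        using openin_continuous_map_preimage[OF cont N(1)] by simp
      moreover have "\<forall>U'\<in>?N. \<forall>u. ordered_basis s1 r U' u \<longrightarrow>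
          G (\<lambda>i. f (u i)) \<noteq> 0 \<and> \<phi> (f ` U') = F (\<lambda>i. f (u i)) / G (\<lambda>i. f (u i))"
        using quot Grass_image(2)[OF V f inj] X by blast
      ultimately show "\<exists>N d. openin (subtopology (zariski s1 r V) X) N \<and> U \<in> N \<and> N \<subseteq> X \<inter> (`) f -` A \<and>
          (\<exists>F G. pluecker_form s1 r V d F \<and> pluecker_form s1 r V d G \<and>
            (\<forall>U'\<in>N. \<forall>u. ordered_basis s1 r U' u \<longrightarrow> G u \<noteq> 0 \<and> \<phi> (f ` U') = F u / G u))"
        using U N pluecker_form_compose[OF f F] pluecker_form_compose[OF f G]
        by (intro exI[of _ ?N] exI[of _ d] conjI exI[of _ "\<lambda>u. F (\<lambda>i. f (u i))"] exI[of _ "\<lambda>u. G (\<lambda>i. f (u i))"]) auto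
    qed
  qed
qed

end

section \<open>Comparison of the two maxima and of the two support varieties\<close>

lemma splitting_iso_inv_into:
  assumes "splitting V" and "splitting_iso V W \<psi>"
  shows "splitting_iso W V (inv_into V \<psi>)"
proof -
  have V: "kE.subspace V" using assms(1) by (simp add: splitting_def)
  have lin: "linear_between alg_scale alg_scale V W \<psi>" and bij: "bij_betw \<psi> V W"
    and proj: "\<forall>v\<in>V. rad_proj (\<psi> v) = rad_proj v"
    using assms(2) by (auto simp: splitting_iso_def)
  have "rad_proj (inv_into V \<psi> w) = rad_proj w" if "w \<in> W" for w
    using that bij proj by (metis bij_betw_def f_inv_into_f inv_into_into)
  then show ?thesis
    using linear_between_inv_into[OF kE.vector_space_axioms V lin bij] bij_betw_inv_into[OF bij]
    by (simp add: splitting_iso_def)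
qed

text \<open>The dimension of the module bounds all values, so \<open>Max\<close> over an infinite
  Grassmannian is a true maximum.\<close>

lemma finite_rad_dim_image:
  fixes act :: "('e::{ab_group_add, finite} \<Rightarrow>\<^sub>0 'k::field) \<Rightarrow> 'm::ab_group_add \<Rightarrow> 'm"
  assumes "fin_dim_module act"
  shows "finite (rad_dim act ` X)"
proof -
  obtain Basis where "kE_module act Basis" using kE_module_exists[OF assms] by blast
  then interpret kE_module act Basis .
  have "rad_dim act ` X \<subseteq> {..S.dimension}"
    using S.dim_subset_UNIV by (auto simp: rad_dim_def)
  then show ?thesis using finite_subset by blast
qed

lemma Grass_image_splitting_iso:
  assumes "splitting V" and "splitting_iso V W \<psi>" and "U \<in> Grass alg_scale r V"
  shows "\<psi> ` U \<in> Grass alg_scale r W"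
proof -
  interpret vector_space_pair alg_scale alg_scale by unfold_locales
  show ?thesis
    using assms Grass_image(1)[of V W \<psi> U r]
    by (auto simp: splitting_def splitting_iso_def bij_betw_def)
qed

text \<open>A plane attaining the maximum keeps its dimension under \<psi>, which gives one
  inequality; the inverse of \<psi> will supply the other.\<close>

lemma max_rad_dim_splitting_iso:
  fixes V W :: "('e::{ab_group_add, finite} \<Rightarrow>\<^sub>0 'k::alg_closed_field) set"
    and act :: "('e \<Rightarrow>\<^sub>0 'k) \<Rightarrow> 'm::ab_group_add \<Rightarrow> 'm"
  assumes char: "CHAR('k) = p" and elem: "elementary_abelian p n TYPE('e)"
    and V: "splitting V" and iso: "splitting_iso V W \<psi>"
    and r: "1 \<le> r" and M: "fin_dim_module act"
  shows "U \<in> Grass alg_scale r V \<Longrightarrow> rad_dim act U = max_rad_dim r V act \<Longrightarrow>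
      rad_dim act (\<psi> ` U) = rad_dim act U"
    and "Grass alg_scale r V \<noteq> {} \<Longrightarrow> max_rad_dim r V act \<le> max_rad_dim r W act"
proof -
  note fin = finite_rad_dim_image[OF M]
  show 1: "rad_dim act (\<psi> ` U) = rad_dim act U"
    if "U \<in> Grass alg_scale r V" "rad_dim act U = max_rad_dim r V act" for U
  proof (rule rad_dim_splitting_iso[OF char elem V iso r M that(1)])
    show "rad_dim act U' \<le> rad_dim act U" if "U' \<in> Grass alg_scale r V" for U'
      unfolding \<open>rad_dim act U = max_rad_dim r V act\<close> max_rad_dim_def using that fin by (intro Max_ge) auto
  qed
  assume "Grass alg_scale r V \<noteq> {}"
  then have "max_rad_dim r V act \<in> rad_dim act ` Grass alg_scale r V"
    unfolding max_rad_dim_def using fin by (intro Max_in) auto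
  then obtain U where U: "U \<in> Grass alg_scale r V" "rad_dim act U = max_rad_dim r V act" by auto
  have "rad_dim act (\<psi> ` U) \<le> max_rad_dim r W act"
    unfolding max_rad_dim_def using fin Grass_image_splitting_iso[OF V iso U(1)] by (intro Max_ge) auto
  then show "max_rad_dim r V act \<le> max_rad_dim r W act" using 1[OF U] U(2) by simp
qed

theorem theorem2p9:
  fixes V W :: "('e::{ab_group_add, finite} \<Rightarrow>\<^sub>0 'k::alg_closed_field) set"
    and \<psi> :: "('e \<Rightarrow>\<^sub>0 'k) \<Rightarrow> ('e \<Rightarrow>\<^sub>0 'k)"
    and act :: "('e \<Rightarrow>\<^sub>0 'k) \<Rightarrow> 'm::ab_group_add \<Rightarrow> 'm"
    and p n r :: nat
  assumes "CHAR('k) = p" and "p > 0"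
    and "elementary_abelian p n TYPE('e)" and "n \<ge> 1"
    and "splitting V" and "splitting W"
    and "splitting_iso V W \<psi>"
    and "1 \<le> r" and "r \<le> n"
    and "fin_dim_module act"
  shows "variety_iso alg_scale r V (Rad_variety r V act) alg_scale r W (Rad_variety r W act)
           (\<lambda>U. \<psi> ` U) \<and>
         (\<forall>U \<in> Grass alg_scale r V. U \<notin> Rad_variety r V act \<longrightarrow>
            rad_dim act U = rad_dim act (\<psi> ` U)) \<and>
         max_rad_dim r V act = max_rad_dim r W act"
proof -
  note V = \<open>splitting V\<close> and W = \<open>splitting W\<close> and iso = \<open>splitting_iso V W \<psi>\<close>
  let ?\<theta> = "inv_into V \<psi>"
  have iso': "splitting_iso W V ?\<theta>" by (rule splitting_iso_inv_into[OF V iso])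
  note maxV = max_rad_dim_splitting_iso[OF assms(1,3) V iso \<open>1 \<le> r\<close> \<open>fin_dim_module act\<close>]
  note maxW = max_rad_dim_splitting_iso[OF assms(1,3) W iso' \<open>1 \<le> r\<close> \<open>fin_dim_module act\<close>]
  note gV = Grass_image_splitting_iso[OF V iso] and gW = Grass_image_splitting_iso[OF W iso']
  have bij: "bij_betw \<psi> V W" using iso by (simp add: splitting_iso_def)
  have sub: "kE.subspace V" "kE.subspace W" using V W by (auto simp: splitting_def)
  have \<theta>\<psi>: "?\<theta> ` \<psi> ` U = U" if "U \<in> Grass alg_scale r V" for U
    using that inv_into_image_cancel[of \<psi> V U] bij by (auto simp: bij_betw_def Grass_def)
  have \<psi>\<theta>: "\<psi> ` ?\<theta> ` U = U" if "U \<in> Grass alg_scale r W" for U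
    using that image_inv_into_cancel[of \<psi> V W U] bij by (auto simp: bij_betw_def Grass_def)
  have max: "max_rad_dim r V act = max_rad_dim r W act"
  proof (cases "Grass alg_scale r V = {}")
    \<comment> \<open>Both Grassmannians are then empty, and both sides are the same value
      \<open>Max {}\<close>.\<close>
    case True
    then have "Grass alg_scale r W = {}" using gW by blast
    then show ?thesis using True by (simp add: max_rad_dim_def)
  next
    case False
    then have "Grass alg_scale r W \<noteq> {}" using gV by blast
    then show ?thesis using False maxV(2) maxW(2) by (intro antisym) auto
  qed
  have le: "rad_dim act U \<le> max_rad_dim r X act" if "U \<in> Grass alg_scale r X" for U X
    unfolding max_rad_dim_def using that finite_rad_dim_image[OF \<open>fin_dim_module act\<close>] by (intro Max_ge) auto
  \<comment> \<open>Were the image maximal, the inverse would carry it back without changing the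
    dimension, making \<open>U\<close> maximal.\<close>
  have XY: "\<psi> ` U \<in> Rad_variety r W act" if U: "U \<in> Rad_variety r V act" for U
  proof -
    have U': "U \<in> Grass alg_scale r V" "rad_dim act U < max_rad_dim r V act"
      using U by (auto simp: Rad_variety_def)
    have "rad_dim act (\<psi> ` U) \<noteq> max_rad_dim r W act"
      using maxW(1)[OF gV[OF U'(1)]] \<theta>\<psi>[OF U'(1)] U'(2) max by auto
    then show ?thesis using gV[OF U'(1)] le[OF gV[OF U'(1)]] by (simp add: Rad_variety_def)
  qed
  have YX: "?\<theta> ` U \<in> Rad_variety r V act" if U: "U \<in> Rad_variety r W act" for U
  proof -
    have U': "U \<in> Grass alg_scale r W" "rad_dim act U < max_rad_dim r W act"
      using U by (auto simp: Rad_variety_def)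
    have "rad_dim act (?\<theta> ` U) \<noteq> max_rad_dim r V act"
      using maxV(1)[OF gW[OF U'(1)]] \<psi>\<theta>[OF U'(1)] U'(2) max by auto
    then show ?thesis using gW[OF U'(1)] le[OF gW[OF U'(1)]] by (simp add: Rad_variety_def)
  qed
  interpret pair: vector_space_pair "alg_scale :: 'k \<Rightarrow> ('e \<Rightarrow>\<^sub>0 'k) \<Rightarrow> _" "alg_scale :: 'k \<Rightarrow> ('e \<Rightarrow>\<^sub>0 'k) \<Rightarrow> _"
    by unfold_locales
  have "variety_morphism alg_scale r V (Rad_variety r V act) alg_scale r W (Rad_variety r W act) ((`) \<psi>)"
    using iso XY by (intro pair.variety_morphism_image sub) (auto simp: splitting_iso_def Rad_variety_def)
  moreover have "variety_morphism alg_scale r W (Rad_variety r W act) alg_scale r V (Rad_variety r V act) ((`) ?\<theta>)"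
    using iso' YX by (intro pair.variety_morphism_image sub) (auto simp: splitting_iso_def Rad_variety_def)
  moreover have "\<forall>U\<in>Rad_variety r V act. ?\<theta> ` \<psi> ` U = U" "\<forall>U\<in>Rad_variety r W act. \<psi> ` ?\<theta> ` U = U"
    using \<theta>\<psi> \<psi>\<theta> by (auto simp: Rad_variety_def)
  ultimately have "variety_iso alg_scale r V (Rad_variety r V act) alg_scale r W (Rad_variety r W act) (\<lambda>U. \<psi> ` U)"
    unfolding variety_iso_def by blast
  moreover have "rad_dim act U = rad_dim act (\<psi> ` U)" if "U \<in> Grass alg_scale r V" "U \<notin> Rad_variety r V act" for U
    using that maxV(1)[OF that(1)] le[OF that(1)] by (auto simp: Rad_variety_def)
  ultimately show ?thesis using max by blast
qed

end
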